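(* Let $\Gamma$ be a finitely generated group, let $p\ge 1$, assume that $\Gamma$ is amenable and that $X$ is a metric space with Markov type $p$. Then for every left-invariant metric $\rho$ on $\Gamma$ such that the ball $B_\rho(e_\Gamma,r)=\{x\in\Gamma:\rho(x,e_\Gamma)\le r\}$ is finite for all $r\ge0$, $$\alpha_X^*(\Gamma,\rho)\ \le\ \frac{1}{p\,\beta_p^*(\Gamma,\rho)}.$$
   Context: Compression: for a metric space $(X,d_X)$, $\alpha_X^*(\Gamma,\rho)$ is the supremum of those $\alpha\ge0$ for which there exist a $\rho$-Lipschitz map $f:\Gamma\to X$ and a constant $c>0$ with $d_X(f(x),f(y))\ge c\,\rho(x,y)^\alpha$ for all $x,y\in\Gamma$ (the supremum of the empty set is read as $0$). Markov type: a Markov chain $\{Z_t\}_{t=0}^\infty$ on $\{1,\dots,n\}$ with transition probabilities $a_{ij}=\Pr(Z_{t+1}=j\mid Z_t=i)$ is stationary if $\pi_i=\Pr(Z_t=i)$ does not depend on $t$, and reversible if $\pi_ia_{ij}=\pi_ja_{ji}$ for all $i,j$. $(X,d_X)$ has Markov type $p\in[1,\infty)$ if there is $K>0$ such that for every $n$, every stationary reversible Markov chain $\{Z_t\}$ on $\{1,\dots,n\}$, every map $f:\{1,\dots,n\}\to X$ and every $t\in\mathbb N$, $\mathbb E[d_X(f(Z_t),f(Z_0))^p]\le K^p\,t\,\mathbb E[d_X(f(Z_1),f(Z_0))^p]$. The parameter $\beta_p^*$: a probability measure $\mu$ on $\Gamma$ is symmetric if $\mu(\{g\})=\mu(\{g^{-1}\})$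 for all $g$. For such $\mu$ let $g_1,g_2,\dots$ be i.i.d. elements of $\Gamma$ with law $\mu$, and set $W_0^\mu=e_\Gamma$, $W_t^\mu=g_1g_2\cdots g_t$. For a sequence $\{\mu_t\}_{t=1}^\infty$ of symmetric probability measures on $\Gamma$ put $$\beta_p^*\left(\{\mu_t\}_{t=1}^\infty,\rho\right)=\limsup_{t\to\infty}\frac{\log\left(\mathbb E_{\mu_t}\left[\rho(W_t^{\mu_t},e_\Gamma)\right]\right)}{\log\left(t\,\mathbb E_{\mu_t}\left[\rho(W_1^{\mu_t},e_\Gamma)^p\right]\right)}.$$ $\beta_p^*(\Gamma,\rho)$ is the supremum of $\beta_p^*(\{\mu_t\}_{t=1}^\infty,\rho)$ over all sequences of symmetric probability measures on $\Gamma$ with $\int_\Gamma\rho(x,e_\Gamma)^p\,d\mu_t(x)<\infty$ for all $t\in\mathbb N$ and $\lim_{t\to\infty}t\,\mu_t(\Gamma\setminus\{e_\Gamma\})=\infty$. Convention: $1/0=+\infty$. *)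

theory Defs
  imports "HOL-Probability.Probability" "HOL-Algebra.Generated_Groups"
begin

section \<open>Groups\<close>

definition finitely_generated_group :: "('a, 'm) monoid_scheme \<Rightarrow> bool" where
  "finitely_generated_group G \<longleftrightarrow>
     group G \<and> (\<exists>S. finite S \<and> S \<subseteq> carrier G \<and> generate G S = carrier G)"

text \<open>Amenability of a discrete group in the sense of von Neumann: there is a finitely additive
  probability measure, defined on all subsets, that is invariant under left translations.\<close>

definition amenable_group :: "('a, 'm) monoid_scheme \<Rightarrow> bool" where
  "amenable_group G \<longleftrightarrow> group G \<and>
     (\<exists>m :: 'a set \<Rightarrow> real.
        (\<forall>A. A \<subseteq> carrier G \<longrightarrow> 0 \<le> m A) \<and>
        m (carrier G) = 1 \<and>
        (\<forall>A B. A \<subseteq> carrier G \<longrightarrow> B \<subseteq> carrier G \<longrightarrow> A \<inter> B = {} \<longrightarrow> m (A \<union> B) = m A + m B) \<and>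
        (\<forall>g A. g \<in> carrier G \<longrightarrow> A \<subseteq> carrier G \<longrightarrow> m (g <#\<^bsub>G\<^esub> A) = m A))"

definition left_invariant_metric :: "('a, 'm) monoid_scheme \<Rightarrow> 'a metric \<Rightarrow> bool" where
  "left_invariant_metric G \<rho> \<longleftrightarrow> mspace \<rho> = carrier G \<and>
     (\<forall>g\<in>carrier G. \<forall>x\<in>carrier G. \<forall>y\<in>carrier G.
        mdist \<rho> (g \<otimes>\<^bsub>G\<^esub> x) (g \<otimes>\<^bsub>G\<^esub> y) = mdist \<rho> x y)"

section \<open>Suprema of exponents\<close>

text \<open>In \<^typ>\<open>ereal\<close> the supremum of the empty set is \<open>-\<infinity>\<close>; the convention for exponents is
  that it is 0.\<close>

definition Sup0 :: "ereal set \<Rightarrow> ereal" where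
  "Sup0 A = (if A = {} then 0 else Sup A)"

section \<open>Compression exponent\<close>

text \<open>Since \<open>0 powr 0 = 0\<close>, the lower bound is vacuous on the diagonal, also for \<open>\<alpha> = 0\<close>.\<close>

definition compression_exponent :: "'b metric \<Rightarrow> 'a metric \<Rightarrow> ereal" where
  "compression_exponent X \<rho> = Sup0 {ereal \<alpha> | \<alpha>. 0 \<le> \<alpha> \<and>
     (\<exists>f c. Lipschitz_continuous_map \<rho> X f \<and> 0 < c \<and>
        (\<forall>x\<in>mspace \<rho>. \<forall>y\<in>mspace \<rho>. c * mdist \<rho> x y powr \<alpha> \<le> mdist X (f x) (f y)))}"

section \<open>Markov type\<close>

text \<open>A Markov chain is given by its initial law \<open>\<pi>\<close> and its transition kernel \<open>a\<close>
  (so \<open>a\<^sub>i\<^sub>j = pmf (a i) j\<close>). \<open>chain_from a t i\<close> is the law of \<open>Z\<^sub>t\<close> given \<open>Z\<^sub>0 = i\<close>, and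
  \<open>chain_joint \<pi> a t\<close> is the joint law of \<open>(Z\<^sub>0, Z\<^sub>t)\<close>.\<close>

primrec chain_from :: "('s \<Rightarrow> 's pmf) \<Rightarrow> nat \<Rightarrow> 's \<Rightarrow> 's pmf" where
  "chain_from a 0 i = return_pmf i"
| "chain_from a (Suc t) i = bind_pmf (chain_from a t i) a"

definition chain_joint :: "'s pmf \<Rightarrow> ('s \<Rightarrow> 's pmf) \<Rightarrow> nat \<Rightarrow> ('s \<times> 's) pmf" where
  "chain_joint \<pi> a t = bind_pmf \<pi> (\<lambda>i. map_pmf (Pair i) (chain_from a t i))"

definition stationary_reversible_chain :: "'s set \<Rightarrow> 's pmf \<Rightarrow> ('s \<Rightarrow> 's pmf) \<Rightarrow> bool" where
  "stationary_reversible_chain S \<pi> a \<longleftrightarrow>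
     set_pmf \<pi> \<subseteq> S \<and> (\<forall>i\<in>S. set_pmf (a i) \<subseteq> S) \<and>
     (\<forall>t. map_pmf snd (chain_joint \<pi> a t) = \<pi>) \<and>
     (\<forall>i\<in>S. \<forall>j\<in>S. pmf \<pi> i * pmf (a i) j = pmf \<pi> j * pmf (a j) i)"

definition has_markov_type :: "'b metric \<Rightarrow> real \<Rightarrow> bool" where
  "has_markov_type X p \<longleftrightarrow> (\<exists>K>0. \<forall>(n::nat) \<pi> a f t.
     stationary_reversible_chain {1..n} \<pi> a \<longrightarrow> f \<in> {1..n} \<rightarrow> mspace X \<longrightarrow>
     measure_pmf.expectation (chain_joint \<pi> a t) (\<lambda>(z0, zt). mdist X (f zt) (f z0) powr p)
       \<le> K powr p * real t *
         measure_pmf.expectation (chain_joint \<pi> a 1) (\<lambda>(z0, z1). mdist X (f z1) (f z0) powr p))"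

section \<open>Random walks and the parameter \<open>\<beta>\<^sub>p\<^sup>*\<close>\<close>

text \<open>A finitely generated group is countable, so its probability measures are exactly the
  \<^const>\<open>pmf\<close>s supported in the carrier.\<close>

definition symmetric_pmf_on :: "('a, 'm) monoid_scheme \<Rightarrow> 'a pmf \<Rightarrow> bool" where
  "symmetric_pmf_on G \<mu> \<longleftrightarrow> set_pmf \<mu> \<subseteq> carrier G \<and>
     (\<forall>g\<in>carrier G. pmf \<mu> g = pmf \<mu> (inv\<^bsub>G\<^esub> g))"

text \<open>The law of \<open>W\<^sub>t = g\<^sub>1 \<cdots> g\<^sub>t\<close> for i.i.d. \<open>g\<^sub>1, \<dots>, g\<^sub>t\<close> with law \<open>\<mu>\<close>.\<close>

definition walk_pmf :: "('a, 'm) monoid_scheme \<Rightarrow> 'a pmf \<Rightarrow> nat \<Rightarrow> 'a pmf" where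
  "walk_pmf G \<mu> t = map_pmf (\<lambda>gs. foldr (\<otimes>\<^bsub>G\<^esub>) gs \<one>\<^bsub>G\<^esub>) (replicate_pmf t \<mu>)"

text \<open>The logarithm with \<open>log 0 = -\<infinity>\<close> (the library has \<open>ln 0 = 0\<close>), needed because a walk may
  be at the identity almost surely at some times.\<close>

definition log_ereal :: "real \<Rightarrow> ereal" where
  "log_ereal x = (if x \<le> 0 then -\<infinity> else ereal (ln x))"

definition beta_star_seq ::
    "('a, 'm) monoid_scheme \<Rightarrow> 'a metric \<Rightarrow> real \<Rightarrow> (nat \<Rightarrow> 'a pmf) \<Rightarrow> ereal" where
  "beta_star_seq G \<rho> p \<mu> = limsup (\<lambda>t.
     log_ereal (measure_pmf.expectation (walk_pmf G (\<mu> t) t) (\<lambda>w. mdist \<rho> w \<one>\<^bsub>G\<^esub>)) /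
     log_ereal (real t *
       measure_pmf.expectation (walk_pmf G (\<mu> t) 1) (\<lambda>w. mdist \<rho> w \<one>\<^bsub>G\<^esub> powr p)))"

text \<open>Sequences are indexed by \<open>t \<ge> 1\<close>; the value \<open>\<mu> 0\<close> is unconstrained and does not affect
  the upper limit. On the trivial group no sequence is admissible.\<close>

definition admissible_seq ::
    "('a, 'm) monoid_scheme \<Rightarrow> 'a metric \<Rightarrow> real \<Rightarrow> (nat \<Rightarrow> 'a pmf) \<Rightarrow> bool" where
  "admissible_seq G \<rho> p \<mu> \<longleftrightarrow>
     (\<forall>t\<ge>1. symmetric_pmf_on G (\<mu> t) \<and>
        integrable (measure_pmf (\<mu> t)) (\<lambda>x. mdist \<rho> x \<one>\<^bsub>G\<^esub> powr p)) \<and>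
     filterlim (\<lambda>t. real t * measure_pmf.prob (\<mu> t) (carrier G - {\<one>\<^bsub>G\<^esub>})) at_top sequentially"

definition beta_star :: "('a, 'm) monoid_scheme \<Rightarrow> 'a metric \<Rightarrow> real \<Rightarrow> ereal" where
  "beta_star G \<rho> p = Sup0 {beta_star_seq G \<rho> p \<mu> | \<mu>. admissible_seq G \<rho> p \<mu>}"

end

theory Submission
  imports Defs
begin

text \<open>
  Let \<open>f\<close> be Lipschitz with \<open>d(f x, f y) \<ge> c \<rho>(x, y)\<^sup>\<alpha>\<close> and let \<open>W\<^sub>t\<close> be the random walk with symmetric
  step law \<open>\<mu>\<close>. If Markov type could be applied to the image under \<open>f\<close> of the walk started at a
  uniformly distributed point of \<open>G\<close>, left invariance of \<open>\<rho>\<close> would give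
  \<open>c\<^sup>p E[\<rho>(W\<^sub>t, e)\<^bsup>\<alpha>p\<^esup>] \<le> K\<^sup>p L\<^sup>p s\<close> with \<open>s = t E[\<rho>(W\<^sub>1, e)\<^sup>p]\<close>. When \<open>\<alpha>p \<ge> 1\<close>, the first moment of \<open>\<rho>(W\<^sub>t, e)\<close>
  is then at most a constant times \<open>s\<^bsup>1/(\<alpha>p)\<^esup>\<close>. Since \<open>s\<close> tends to infinity along an admissible
  sequence, taking logarithms shows \<open>\<beta>\<^sub>p\<^sup>* \<le> 1/(\<alpha>p)\<close>.

  An infinite group has no uniform distribution; amenability supplies a substitute
  (\<open>amenable_interior\<close>): a finite set \<open>\<Omega>\<close>, at least half of whose points are starting points from
  which a given finite set of increments does not leave \<open>\<Omega>\<close>. The walk confined to \<open>\<Omega>\<close>, in which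
  steps out of \<open>\<Omega>\<close> are suppressed, is reversible for the uniform law on \<open>\<Omega>\<close> because \<open>\<mu>\<close> is symmetric,
  and from those starting points it is the walk on the group up to time \<open>t\<close>. This costs only a
  factor 2, which no exponent sees. Half of the points suffice, so the set comes from
  a single application of Hall's marriage theorem: if \<open>|KF| \<ge> 2|F|\<close> for all finite \<open>F\<close>, there is an
  injection of two copies of \<open>G\<close> into \<open>G\<close> that moves points by left multiplication by elements of
  \<open>K\<close>, and an invariant mean would give its image mass 2. The argument
  needs finitely supported \<open>\<mu>\<close>; truncating long steps and Fatou's lemma remove this restriction
  (\<open>walk_displacement_bound\<close>).

  When \<open>\<alpha>p < 1\<close>, the bound \<open>\<beta>\<^sub>p\<^sup>* \<le> 1\<close> suffices. It holds because \<open>E[\<rho>(W\<^sub>t, e)] \<le> t E[\<rho>(W\<^sub>1, e)]\<close>, and \<open>\<rho>\<close> is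
  bounded by a multiple of \<open>\<rho>\<^sup>p\<close> as finite balls keep the points other than \<open>e\<close> at a positive distance from \<open>e\<close>.
  Finally, to pass from \<open>\<alpha> p \<beta>\<^sub>p\<^sup>* \<le> 1\<close> to the quotient one needs \<open>\<beta>\<^sub>p\<^sup>* \<ge> 0\<close>, for which a walk with a fixed
  step law on a nontrivial group is a witness (\<open>beta_star_nonneg\<close>).
\<close>

section \<open>Hall's marriage theorem for infinite families of finite sets\<close>

definition hall_condition :: "('i \<times> 'b) set \<Rightarrow> 'i set \<Rightarrow> bool" where
  "hall_condition R I \<longleftrightarrow> (\<forall>J. J \<subseteq> I \<longrightarrow> finite J \<longrightarrow> card J \<le> card (R `` J))"

text \<open>If deleting either edge destroyed the condition, there would be violating sets \<open>J\<close> and \<open>K\<close>,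
  both containing \<open>i\<close>. Since \<open>x\<close> survives in the neighbourhood of \<open>K\<close> and \<open>y\<close> in that of \<open>J\<close>, the two
  reduced neighbourhoods together cover the full neighbourhood of \<open>J \<union> K\<close>, and their intersection
  contains that of \<open>J \<inter> K - {i}\<close>. Adding cardinalities loses only 1, for the point \<open>i\<close>, while the two
  violations together lose 2.\<close>
lemma hall_condition_delete:
  assumes hall: "hall_condition R I" and fin: "\<And>i. i \<in> I \<Longrightarrow> finite (R `` {i})"
    and xy: "(i, x) \<in> R" "(i, y) \<in> R" "x \<noteq> y"
  shows "hall_condition (R - {(i, x)}) I \<or> hall_condition (R - {(i, y)}) I"
proof (rule ccontr)
  assume "\<not> ?thesis"
  then obtain J K where J: "J \<subseteq> I" "finite J" "card ((R - {(i, x)}) `` J) < card J"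
    and K: "K \<subseteq> I" "finite K" "card ((R - {(i, y)}) `` K) < card K"
    unfolding hall_condition_def by (metis not_less)
  have finR: "finite (R `` H)" if "H \<subseteq> I" "finite H" for H
    using fin that by (subst Image_eq_UN) auto
  have mem: "i \<in> H" if "H \<subseteq> I" "finite H" "card ((R - {(i, z)}) `` H) < card H" for H z
  proof (rule ccontr)
    assume "i \<notin> H"
    then have "(R - {(i, z)}) `` H = R `` H" by auto
    moreover have "card H \<le> card (R `` H)"
      using that hall unfolding hall_condition_def by blast
    ultimately show False using that(3) by simp
  qed
  have i: "i \<in> J" "i \<in> K" using mem J K by blast+
  define P Q where "P = (R - {(i, x)}) `` J" and "Q = (R - {(i, y)}) `` K"
  have PQ: "finite P" "finite Q"
    unfolding P_def Q_def
    by (rule finite_subset[OF _ finR[OF J(1,2)]], blast, rule finite_subset[OF _ finR[OF K(1,2)]], blast)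
  have "R `` (J \<union> K) \<subseteq> P \<union> Q"
    using xy i unfolding P_def Q_def by auto
  then have 1: "card (J \<union> K) \<le> card (P \<union> Q)"
    using hall J K PQ unfolding hall_condition_def
    by (meson card_mono finite_UnI le_trans Un_least)
  have "R `` (J \<inter> K - {i}) \<subseteq> P \<inter> Q"
    unfolding P_def Q_def by auto
  moreover have "card (J \<inter> K - {i}) \<le> card (R `` (J \<inter> K - {i}))"
    using hall J K unfolding hall_condition_def by (simp add: le_infI1 subset_iff)
  ultimately have 2: "card (J \<inter> K - {i}) \<le> card (P \<inter> Q)"
    using PQ by (meson card_mono finite_Int le_trans)
  have "card (J \<inter> K) = Suc (card (J \<inter> K - {i}))"
    using i J by (intro card.remove) auto
  then have "card J + card K \<le> Suc (card P + card Q)"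
    using 1 2 card_Un_Int[OF PQ] card_Un_Int[OF J(2) K(2)] by linarith
  moreover have "card P < card J" "card Q < card K"
    using J K unfolding P_def Q_def by auto
  ultimately show False by linarith
qed

text \<open>By Zorn's lemma, delete as many edges as possible without violating Hall's condition. By
  the preceding lemma no vertex of \<open>I\<close> retains two neighbours, and Hall's condition for one- and
  two-element sets says that what remains is the graph of an injective function.\<close>
theorem hall_marriage:
  fixes A :: "'i \<Rightarrow> 'b set"
  assumes fin: "\<And>i. i \<in> I \<Longrightarrow> finite (A i)"
    and hall: "\<And>J. J \<subseteq> I \<Longrightarrow> finite J \<Longrightarrow> card J \<le> card (\<Union>(A ` J))"
  obtains f where "inj_on f I" "\<And>i. i \<in> I \<Longrightarrow> f i \<in> A i"
proof -
  define E where "E = Sigma I A"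
  define \<D> where "\<D> = {D. hall_condition (E - D) I}"
  have EJ: "E `` J = \<Union>(A ` J)" if "J \<subseteq> I" for J
    using that unfolding E_def by auto
  have "{} \<in> \<D>"
    using hall EJ unfolding \<D>_def hall_condition_def by simp
  moreover have "\<Union>\<C> \<in> \<D>" if \<C>: "\<C> \<noteq> {}" "subset.chain \<D> \<C>" for \<C>
    unfolding \<D>_def hall_condition_def
  proof (intro CollectI allI impI)
    fix J assume J: "J \<subseteq> I" "finite J"
    have "finite (Sigma J A \<inter> \<Union>\<C>)"
      using J fin by (intro finite_Int disjI1 finite_SigmaI) auto
    \<comment> \<open>Only finitely many deletions concern \<open>J\<close>, so one member of the chain makes them all.\<close>
    then obtain D where D: "D \<in> \<C>" "Sigma J A \<inter> \<Union>\<C> \<subseteq> D"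
      using finite_subset_Union_chain[OF _ _ \<C>] by (metis inf_le2)
    have "card J \<le> card ((E - D) `` J)"
      using D \<C> J unfolding \<D>_def hall_condition_def subset_chain_def by blast
    also have "(E - D) `` J = (E - \<Union>\<C>) `` J"
      using D unfolding E_def by blast
    finally show "card J \<le> card ((E - \<Union>\<C>) `` J)" .
  qed
  ultimately obtain M where M: "M \<in> \<D>" and max: "\<And>D. D \<in> \<D> \<Longrightarrow> M \<subseteq> D \<Longrightarrow> D = M"
    using subset_Zorn_nonempty[of \<D>] by blast
  define R where "R = E - M"
  have R: "hall_condition R I" using M unfolding \<D>_def R_def by simp
  have finR: "finite (R `` {i})" if "i \<in> I" for i
    using fin[OF that] by (rule rev_finite_subset) (auto simp: R_def E_def)
  have uniq: "x = y" if "(i, x) \<in> R" "(i, y) \<in> R" for i x y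
  proof (rule ccontr)
    assume "x \<noteq> y"
    moreover have "\<not> hall_condition (R - {(i, z)}) I" if "(i, z) \<in> R" for z
    proof
      assume "hall_condition (R - {(i, z)}) I"
      moreover have "R - {(i, z)} = E - insert (i, z) M" unfolding R_def by auto
      ultimately have "insert (i, z) M \<in> \<D>" unfolding \<D>_def by simp
      then have "(i, z) \<in> M" using max[of "insert (i, z) M"] by blast
      then show False using that unfolding R_def by simp
    qed
    ultimately show False using hall_condition_delete[OF R finR] that by blast
  qed
  have "\<exists>x. (i, x) \<in> R" if "i \<in> I" for i
  proof -
    have "card {i} \<le> card (R `` {i})"
      by (rule R[unfolded hall_condition_def, rule_format]) (use that in auto)
    then have "R `` {i} \<noteq> {}" by (intro notI) simp
    then show ?thesis by blast
  qed
  then obtain f where f: "\<And>i. i \<in> I \<Longrightarrow> (i, f i) \<in> R" by metis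
  have "inj_on f I"
  proof (rule inj_onI, rule ccontr)
    fix i j assume ij: "i \<in> I" "j \<in> I" "f i = f j" "i \<noteq> j"
    have "R `` {i, j} = {f i}" using f[OF ij(1)] f[OF ij(2)] ij(3) uniq by auto
    moreover have "card {i, j} \<le> card (R `` {i, j})"
      by (rule R[unfolded hall_condition_def, rule_format]) (use ij in auto)
    ultimately show False using ij by simp
  qed
  then show thesis using that f unfolding R_def E_def by blast
qed

section \<open>Finite sets of small expansion in amenable groups\<close>

lemma finitely_additive_sum:
  fixes m :: "'a set \<Rightarrow> real"
  assumes add: "\<And>A B. A \<subseteq> U \<Longrightarrow> B \<subseteq> U \<Longrightarrow> A \<inter> B = {} \<Longrightarrow> m (A \<union> B) = m A + m B"
    and "finite I" "\<And>i. i \<in> I \<Longrightarrow> A i \<subseteq> U" "disjoint_family_on A I"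
  shows "m (\<Union>(A ` I)) = (\<Sum>i\<in>I. m (A i))"
  using assms(2-)
proof (induction I)
  case empty
  have "m ({} \<union> {}) = m {} + m {}" by (intro add) auto
  then show ?case by simp
next
  case (insert i I)
  have "A i \<inter> \<Union>(A ` I) = {}"
    using insert.prems(2) insert.hyps by (fastforce simp: disjoint_family_on_def)
  then have "m (A i \<union> \<Union>(A ` I)) = m (A i) + m (\<Union>(A ` I))"
    using insert.prems(1) by (intro add) auto
  moreover have "m (\<Union>(A ` I)) = (\<Sum>i\<in>I. m (A i))"
    using insert.prems by (intro insert.IH) (auto simp: disjoint_family_on_def)
  ultimately show ?case using insert.hyps by simp
qed

text \<open>Cut the two copies of \<open>G\<close> into the pieces on which \<open>f\<close> is multiplication by a fixed \<open>k \<in> K\<close>.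
  The pieces have total mass 2, and so do their disjoint images in \<open>G\<close>, whose mass is 1.\<close>
lemma amenable_no_doubling_injection:
  fixes G (structure)
  assumes am: "amenable_group G" and K: "finite K" "K \<subseteq> carrier G"
    and inj: "inj_on f (carrier G \<times> (UNIV :: bool set))"
    and f: "\<And>x b. x \<in> carrier G \<Longrightarrow> f (x, b) \<in> (\<lambda>k. k \<otimes> x) ` K"
  shows False
proof -
  interpret group G using am by (simp add: amenable_group_def)
  obtain m :: "_ set \<Rightarrow> real" where
    pos: "\<And>A. A \<subseteq> carrier G \<Longrightarrow> 0 \<le> m A" and one: "m (carrier G) = 1" and
    add: "\<And>A B. A \<subseteq> carrier G \<Longrightarrow> B \<subseteq> carrier G \<Longrightarrow> A \<inter> B = {} \<Longrightarrow> m (A \<union> B) = m A + m B" and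
    inv: "\<And>g A. g \<in> carrier G \<Longrightarrow> A \<subseteq> carrier G \<Longrightarrow> m (g <# A) = m A"
    using am unfolding amenable_group_def by blast
  define P where "P = (\<lambda>(b, k). {x \<in> carrier G. f (x, b) = k \<otimes> x})"
  define Q where "Q = (\<lambda>(b, k). k <# P (b, k))"
  have sub: "P i \<subseteq> carrier G" for i unfolding P_def by (cases i) auto
  have QP: "m (Q i) = m (P i)" if "i \<in> UNIV \<times> K" for i
    using that inv[OF _ sub] K unfolding Q_def by auto
  have half: "(\<Sum>k\<in>K. m (P (b, k))) = 1" for b
  proof -
    have "(\<Sum>k\<in>K. m (P (b, k))) = m (\<Union>k\<in>K. P (b, k))"
      by (rule finitely_additive_sum[where U = "carrier G", symmetric])
         (use K in \<open>auto intro: add simp: sub disjoint_family_on_def, auto simp: P_def subset_iff\<close>)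
    also have "(\<Union>k\<in>K. P (b, k)) = carrier G"
      using f unfolding P_def by fastforce
    finally show ?thesis using one by simp
  qed
  have Qsub: "Q i \<subseteq> carrier G" if "i \<in> UNIV \<times> K" for i
    using that K sub unfolding Q_def by (auto simp: l_coset_def P_def)
  have dis: "disjoint_family_on Q (UNIV \<times> K)"
    unfolding disjoint_family_on_def
  proof (intro ballI impI, rule ccontr)
    fix i j assume ij: "i \<in> UNIV \<times> K" "j \<in> UNIV \<times> K" "i \<noteq> j" "Q i \<inter> Q j \<noteq> {}"
    obtain b k c l where [simp]: "i = (b, k)" "j = (c, l)" by fastforce
    obtain x y where x: "x \<in> carrier G" "f (x, b) = k \<otimes> x" and
      y: "y \<in> carrier G" "f (y, c) = l \<otimes> y" and "k \<otimes> x = l \<otimes> y"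
      using ij(4) unfolding Q_def P_def l_coset_def by auto
    then have "(x, b) = (y, c)" using inj by (intro inj_onD[OF inj]) auto
    moreover have "k \<in> carrier G" "l \<in> carrier G" using ij K by auto
    ultimately have "i = j" using \<open>k \<otimes> x = l \<otimes> y\<close> x by simp
    then show False using ij by simp
  qed
  have "2 = (\<Sum>b\<in>(UNIV :: bool set). \<Sum>k\<in>K. m (P (b, k)))"
    by (simp add: half)
  also have "\<dots> = (\<Sum>i\<in>UNIV \<times> K. m (Q i))"
    by (simp add: sum.cartesian_product QP)
  also have "\<dots> = m (\<Union>(Q ` (UNIV \<times> K)))"
    by (rule finitely_additive_sum[where U = "carrier G", symmetric])
       (use K Qsub dis in \<open>auto intro!: add\<close>)
  also have "\<dots> \<le> m (carrier G)"
  proof -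
    define V where "V = \<Union>(Q ` (UNIV \<times> K))"
    have V: "V \<subseteq> carrier G" unfolding V_def using Qsub by blast
    then have "m (carrier G) = m V + m (carrier G - V)"
      using add[of V "carrier G - V"] by (simp add: Un_absorb1)
    then show ?thesis using pos[of "carrier G - V"] unfolding V_def by simp
  qed
  finally show False using one by simp
qed

text \<open>Otherwise the neighbourhoods \<open>Kx\<close>, each taken twice, satisfy Hall's condition, and the
  resulting injection contradicts the preceding lemma.\<close>
lemma amenable_small_product:
  fixes G (structure)
  assumes am: "amenable_group G" and K: "finite K" "K \<subseteq> carrier G"
  obtains F where "finite F" "F \<subseteq> carrier G" "F \<noteq> {}"
    "card (\<Union>x\<in>F. (\<lambda>k. k \<otimes> x) ` K) < 2 * card F"
proof (rule ccontr)
  note out = that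
  interpret group G using am by (simp add: amenable_group_def)
  assume "\<not> thesis"
  then have no: "2 * card F \<le> card (\<Union>x\<in>F. (\<lambda>k. k \<otimes> x) ` K)"
    if "finite F" "F \<subseteq> carrier G" "F \<noteq> {}" for F
    using that out[of F] by (auto simp: not_less)
  define A where "A = (\<lambda>(x, b::bool). (\<lambda>k. k \<otimes> x) ` K)"
  have hall: "card J \<le> card (\<Union>(A ` J))" if J: "J \<subseteq> carrier G \<times> UNIV" "finite J" for J
  proof (cases "J = {}")
    case False
    have "card J \<le> card (fst ` J \<times> (UNIV :: bool set))"
      using J by (intro card_mono) force+
    also have "\<dots> = 2 * card (fst ` J)" by (simp add: card_cartesian_product)
    also have "\<dots> \<le> card (\<Union>x\<in>fst ` J. (\<lambda>k. k \<otimes> x) ` K)"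
      using J False by (intro no) auto
    also have "(\<Union>x\<in>fst ` J. (\<lambda>k. k \<otimes> x) ` K) = \<Union>(A ` J)"
      unfolding A_def by force
    finally show ?thesis .
  qed simp
  have "finite (A i)" for i using K unfolding A_def by (cases i) auto
  then obtain f where "inj_on f (carrier G \<times> UNIV)"
    "\<And>i. i \<in> carrier G \<times> UNIV \<Longrightarrow> f i \<in> A i"
    using hall_marriage[of "carrier G \<times> UNIV" A] hall by metis
  then show False
    by (intro amenable_no_doubling_injection[OF am K, of f]) (force simp: A_def)+
qed

text \<open>Inversion turns \<open>|KF| < 2|F|\<close> with \<open>K = T\<^bsup>-1\<^esup>\<close> into a statement about right multiplication, the
  side on which the walk multiplies.\<close>
lemma amenable_interior:
  fixes G (structure)
  assumes am: "amenable_group G" and T: "finite T" "T \<subseteq> carrier G"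
  obtains F \<Omega> where "finite \<Omega>" "\<Omega> \<subseteq> carrier G" "F \<subseteq> carrier G" "finite F" "F \<noteq> {}"
    "\<And>x w. x \<in> F \<Longrightarrow> w \<in> T \<Longrightarrow> x \<otimes> w \<in> \<Omega>" "card \<Omega> \<le> 2 * card F"
proof -
  interpret group G using am by (simp add: amenable_group_def)
  have invT: "finite (m_inv G ` T)" "m_inv G ` T \<subseteq> carrier G" using T by auto
  obtain E where E: "finite E" "E \<subseteq> carrier G" "E \<noteq> {}"
    "card (\<Union>x\<in>E. (\<lambda>k. k \<otimes> x) ` (m_inv G ` T)) < 2 * card E"
    using amenable_small_product[OF am invT] by metis
  define D where "D = (\<Union>x\<in>E. (\<lambda>k. k \<otimes> x) ` (m_inv G ` T))"
  have D: "finite D" "D \<subseteq> carrier G" using E T unfolding D_def by auto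
  have "x \<otimes> w \<in> m_inv G ` D" if "x \<in> m_inv G ` E" "w \<in> T" for x w
  proof -
    obtain y where y: "y \<in> E" "x = inv y" using \<open>x \<in> m_inv G ` E\<close> by blast
    then have "x \<otimes> w = inv (inv w \<otimes> y)"
      using E T that by (simp add: inv_mult_group subset_iff)
    then show ?thesis using y that unfolding D_def by blast
  qed
  moreover have "card (m_inv G ` D) \<le> 2 * card (m_inv G ` E)"
  proof -
    have "inj_on (m_inv G) E" using E by (intro inj_onI) (metis inv_inv subsetD)
    then have "card (m_inv G ` E) = card E" by (rule card_image)
    moreover have "card (m_inv G ` D) \<le> card D" using D(1) by (rule card_image_le)
    ultimately show ?thesis using E(4) unfolding D_def by linarith
  qed
  ultimately show thesis
    using D E by (intro that[of "m_inv G ` D" "m_inv G ` E"]) auto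
qed

section \<open>The law of the random walk\<close>

lemma walk_pmf_0 [simp]: "walk_pmf G \<mu> 0 = return_pmf \<one>\<^bsub>G\<^esub>"
  by (simp add: walk_pmf_def)

lemma walk_pmf_Suc:
  "walk_pmf G \<mu> (Suc t) = bind_pmf \<mu> (\<lambda>g. map_pmf ((\<otimes>\<^bsub>G\<^esub>) g) (walk_pmf G \<mu> t))"
  by (simp add: walk_pmf_def map_pmf_def bind_assoc_pmf bind_return_pmf)

lemma set_walk_pmf:
  fixes G (structure)
  assumes "group G" "set_pmf \<mu> \<subseteq> carrier G"
  shows "set_pmf (walk_pmf G \<mu> t) \<subseteq> carrier G"
proof -
  interpret group G by fact
  show ?thesis using assms by (induction t) (auto simp: walk_pmf_Suc)
qed

lemma walk_pmf_1:
  fixes G (structure)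
  assumes "group G" "set_pmf \<mu> \<subseteq> carrier G"
  shows "walk_pmf G \<mu> 1 = \<mu>"
proof -
  interpret group G by fact
  have "walk_pmf G \<mu> 1 = map_pmf (\<lambda>g. g \<otimes> \<one>) \<mu>"
    unfolding One_nat_def by (simp add: walk_pmf_Suc map_pmf_def bind_return_pmf)
  also have "\<dots> = map_pmf id \<mu>"
    using assms by (intro map_pmf_cong) auto
  finally show ?thesis by simp
qed

text \<open>The walk is defined through products \<open>g\<^sub>1(g\<^sub>2(\<dots>))\<close>, which unfold on the left; as a Markov chain
  it evolves by multiplication on the right.\<close>
lemma walk_pmf_Suc_right:
  fixes G (structure)
  assumes "group G" "set_pmf \<mu> \<subseteq> carrier G"
  shows "walk_pmf G \<mu> (Suc t) = bind_pmf (walk_pmf G \<mu> t) (\<lambda>w. map_pmf ((\<otimes>) w) \<mu>)"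
proof -
  interpret group G by fact
  show ?thesis
  proof (induction t)
    case 0
    have "map_pmf ((\<otimes>) \<one>) \<mu> = map_pmf id \<mu>"
      using assms by (intro map_pmf_cong) auto
    then show ?case using walk_pmf_1[OF assms] by (simp add: bind_return_pmf)
  next
    case (Suc t)
    have "walk_pmf G \<mu> (Suc (Suc t)) =
        bind_pmf \<mu> (\<lambda>g. bind_pmf (walk_pmf G \<mu> t) (\<lambda>w. map_pmf (\<lambda>h. g \<otimes> (w \<otimes> h)) \<mu>))"
      by (subst walk_pmf_Suc, subst Suc.IH) (simp add: map_bind_pmf map_pmf_comp)
    also have "\<dots> = bind_pmf \<mu> (\<lambda>g. bind_pmf (walk_pmf G \<mu> t) (\<lambda>w. map_pmf (\<lambda>h. g \<otimes> w \<otimes> h) \<mu>))"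
      using assms(2) set_walk_pmf[OF assms, of t]
      by (intro bind_pmf_cong map_pmf_cong) (auto simp: m_assoc subset_iff)
    also have "\<dots> = bind_pmf (walk_pmf G \<mu> (Suc t)) (\<lambda>w. map_pmf ((\<otimes>) w) \<mu>)"
      by (simp add: walk_pmf_Suc bind_assoc_pmf bind_map_pmf)
    finally show ?case .
  qed
qed

lemma finite_set_walk_pmf:
  assumes "finite (set_pmf \<mu>)"
  shows "finite (set_pmf (walk_pmf G \<mu> t))"
  using assms by (induction t) (auto simp: walk_pmf_Suc)

section \<open>Reversible chains and Markov type on finite sets\<close>

lemma set_chain_from:
  assumes "\<And>i. i \<in> S \<Longrightarrow> set_pmf (a i) \<subseteq> S" "i \<in> S"
  shows "set_pmf (chain_from a t i) \<subseteq> S"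
proof (induction t)
  case (Suc t)
  then show ?case using assms(1) by fastforce
qed (use assms in simp)

lemma map_snd_chain_joint: "map_pmf snd (chain_joint \<pi> a t) = bind_pmf \<pi> (chain_from a t)"
  by (simp add: chain_joint_def map_bind_pmf map_pmf_comp)

lemma detailed_balance_imp_stationary_reversible:
  assumes S: "finite S" "set_pmf \<pi> \<subseteq> S" "\<And>i. i \<in> S \<Longrightarrow> set_pmf (a i) \<subseteq> S"
    and db: "\<And>i j. i \<in> S \<Longrightarrow> j \<in> S \<Longrightarrow> pmf \<pi> i * pmf (a i) j = pmf \<pi> j * pmf (a j) i"
  shows "stationary_reversible_chain S \<pi> a"
proof -
  have step: "bind_pmf \<pi> a = \<pi>"
  proof (rule pmf_eqI)
    fix j
    have "pmf (bind_pmf \<pi> a) j = (\<Sum>i\<in>S. pmf (a i) j * pmf \<pi> i)"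
      unfolding pmf_bind using S by (intro integral_measure_pmf_real) auto
    also have "\<dots> = pmf \<pi> j"
    proof (cases "j \<in> S")
      case True
      have "(\<Sum>i\<in>S. pmf (a i) j * pmf \<pi> i) = (\<Sum>i\<in>S. pmf \<pi> j * pmf (a j) i)"
        using db True by (intro sum.cong) (auto simp: mult.commute)
      also have "\<dots> = pmf \<pi> j"
        using S True by (simp add: sum_distrib_left[symmetric] sum_pmf_eq_1)
      finally show ?thesis .
    next
      case False
      then have "pmf (a i) j = 0" if "i \<in> S" for i
        using S(3)[OF that] by (meson pmf_eq_0_set_pmf subsetD)
      moreover have "pmf \<pi> j = 0" using False S(2) by (meson pmf_eq_0_set_pmf subsetD)
      ultimately show ?thesis by simp
    qed
    finally show "pmf (bind_pmf \<pi> a) j = pmf \<pi> j" .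
  qed
  have "bind_pmf \<pi> (chain_from a t) = \<pi>" for t
  proof (induction t)
    case (Suc t)
    then show ?case by (simp add: bind_assoc_pmf[symmetric] step)
  qed (simp add: bind_return_pmf')
  then show ?thesis
    using assms unfolding stationary_reversible_chain_def map_snd_chain_joint by auto
qed

text \<open>The inequality that defines Markov type, for one state space of arbitrary type, so that the
  walk can be studied on a subset of the group.\<close>
definition markov_type_bound :: "'b metric \<Rightarrow> real \<Rightarrow> real \<Rightarrow> 's set \<Rightarrow> bool" where
  "markov_type_bound X p K S \<longleftrightarrow> (\<forall>\<pi> a f t.
     stationary_reversible_chain S \<pi> a \<longrightarrow> f \<in> S \<rightarrow> mspace X \<longrightarrow>
     measure_pmf.expectation (chain_joint \<pi> a t) (\<lambda>(z0, zt). mdist X (f zt) (f z0) powr p)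
       \<le> K powr p * real t *
         measure_pmf.expectation (chain_joint \<pi> a 1) (\<lambda>(z0, z1). mdist X (f z1) (f z0) powr p))"

lemma pmf_map_inj_on:
  assumes "inj_on f S" "set_pmf M \<subseteq> S" "x \<in> S"
  shows "pmf (map_pmf f M) (f x) = pmf M x"
proof (cases "x \<in> set_pmf M")
  case True
  then show ?thesis using assms by (intro pmf_map_inj) (auto intro: inj_on_subset)
next
  case False
  then have "f x \<notin> set_pmf (map_pmf f M)" using assms by (auto dest: inj_onD)
  then show ?thesis using False by (metis pmf_eq_0_set_pmf)
qed

text \<open>Enumerating \<open>S\<close> by \<open>{1..card S}\<close> transports the chain to the state spaces of the definition.\<close>
lemma markov_type_bound_finite:
  assumes K: "\<And>n. markov_type_bound X p K {1..n::nat}" and S: "finite S"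
  shows "markov_type_bound X p K S"
  unfolding markov_type_bound_def
proof (intro allI impI)
  fix \<pi> a f t
  assume ch: "stationary_reversible_chain S \<pi> a" and f: "f \<in> S \<rightarrow> mspace X"
  have \<pi>S: "set_pmf \<pi> \<subseteq> S"
    using ch unfolding stationary_reversible_chain_def by blast
  have aS: "set_pmf (a x) \<subseteq> S" if "x \<in> S" for x
    using ch that unfolding stationary_reversible_chain_def by blast
  have stat: "map_pmf snd (chain_joint \<pi> a s) = \<pi>" for s
    using ch unfolding stationary_reversible_chain_def by blast
  have db: "pmf \<pi> x * pmf (a x) y = pmf \<pi> y * pmf (a y) x" if "x \<in> S" "y \<in> S" for x y
    using ch that unfolding stationary_reversible_chain_def by blast
  obtain h where h: "bij_betw h S {1..card S}"
    using ex_bij_betw_finite_nat[OF S] bij_betw_trans bij_betw_iff_card[OF S, of "{1..card S}"] by auto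
  define k where "k = inv_into S h"
  have kh [simp]: "k (h x) = x" if "x \<in> S" for x
    using h that unfolding k_def bij_betw_def by simp
  have k: "k i \<in> S" "h (k i) = i" if "i \<in> {1..card S}" for i
    using bij_betw_inv_into_right[OF h that] bij_betwE[OF bij_betw_inv_into[OF h]] that
    unfolding k_def by auto
  define \<pi>' where "\<pi>' = map_pmf h \<pi>"
  define a' where "a' = (\<lambda>i. map_pmf h (a (k i)))"
  have chS: "y \<in> S" if "y \<in> set_pmf (chain_from a s x)" "x \<in> S" for s x y
    using set_chain_from[of S a x s, OF aS that(2)] that(1) by blast
  have transport: "chain_from a' s (h x) = map_pmf h (chain_from a s x)" if "x \<in> S" for s x
  proof (induction s)
    case (Suc s)
    have "chain_from a' (Suc s) (h x) = bind_pmf (chain_from a s x) (\<lambda>y. a' (h y))"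
      by (simp add: Suc bind_map_pmf)
    also have "\<dots> = bind_pmf (chain_from a s x) (\<lambda>y. map_pmf h (a y))"
      using that by (intro bind_pmf_cong refl) (simp add: a'_def chS)
    finally show ?case by (simp add: map_bind_pmf)
  qed simp
  have joint: "chain_joint \<pi>' a' s = map_pmf (map_prod h h) (chain_joint \<pi> a s)" for s
  proof -
    have "chain_joint \<pi>' a' s = bind_pmf \<pi> (\<lambda>x. map_pmf (Pair (h x)) (chain_from a' s (h x)))"
      by (simp add: chain_joint_def \<pi>'_def bind_map_pmf)
    also have "\<dots> = bind_pmf \<pi> (\<lambda>x. map_pmf (Pair (h x)) (map_pmf h (chain_from a s x)))"
      using \<pi>S by (intro bind_pmf_cong refl) (simp add: transport subset_iff)
    finally show ?thesis by (simp add: chain_joint_def map_bind_pmf map_pmf_comp)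
  qed
  have "stationary_reversible_chain {1..card S} \<pi>' a'"
    unfolding stationary_reversible_chain_def
  proof (intro conjI ballI allI)
    show "set_pmf \<pi>' \<subseteq> {1..card S}"
      using \<pi>S h unfolding \<pi>'_def bij_betw_def by auto
    show "set_pmf (a' i) \<subseteq> {1..card S}" if "i \<in> {1..card S}" for i
      using aS[OF k(1)[OF that]] h unfolding a'_def bij_betw_def by auto
    show "map_pmf snd (chain_joint \<pi>' a' s) = \<pi>'" for s
    proof -
      have "map_pmf snd (chain_joint \<pi>' a' s) = map_pmf h (map_pmf snd (chain_joint \<pi> a s))"
        by (simp add: joint map_pmf_comp)
      then show ?thesis by (simp add: stat \<pi>'_def)
    qed
    fix i j assume i: "i \<in> {1..card S}" and j: "j \<in> {1..card S}"
    have inj: "inj_on h S" using h by (rule bij_betw_imp_inj_on)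
    have "pmf \<pi>' l = pmf \<pi> (k l)" "pmf (a' l') l = pmf (a (k l')) (k l)"
      if "l \<in> {1..card S}" "l' \<in> {1..card S}" for l l'
      using pmf_map_inj_on[OF inj, of \<pi> "k l"] pmf_map_inj_on[OF inj, of "a (k l')" "k l"]
        \<pi>S aS[OF k(1), of l'] k that unfolding \<pi>'_def a'_def by simp_all
    then show "pmf \<pi>' i * pmf (a' i) j = pmf \<pi>' j * pmf (a' j) i"
      using i j db[OF k(1)[OF i] k(1)[OF j]] by simp
  qed
  moreover have "f \<circ> k \<in> {1..card S} \<rightarrow> mspace X" using f k by auto
  moreover have "measure_pmf.expectation (chain_joint \<pi>' a' s)
        (\<lambda>(z0, zt). mdist X ((f \<circ> k) zt) ((f \<circ> k) z0) powr p)
      = measure_pmf.expectation (chain_joint \<pi> a s) (\<lambda>(z0, zt). mdist X (f zt) (f z0) powr p)" for s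
  proof -
    have "set_pmf (chain_joint \<pi> a s) \<subseteq> S \<times> S"
    proof
      fix z assume "z \<in> set_pmf (chain_joint \<pi> a s)"
      then obtain x y where "x \<in> set_pmf \<pi>" "y \<in> set_pmf (chain_from a s x)" "z = (x, y)"
        unfolding chain_joint_def by auto
      then show "z \<in> S \<times> S" using \<pi>S chS by blast
    qed
    then show ?thesis
      unfolding joint integral_map_pmf
      by (intro integral_cong_AE) (auto simp: AE_measure_pmf_iff split: prod.split)
  qed
  ultimately show "measure_pmf.expectation (chain_joint \<pi> a t) (\<lambda>(z0, zt). mdist X (f zt) (f z0) powr p)
       \<le> K powr p * real t *
         measure_pmf.expectation (chain_joint \<pi> a 1) (\<lambda>(z0, z1). mdist X (f z1) (f z0) powr p)"
    using K[of "card S"] unfolding markov_type_bound_def by metis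
qed

section \<open>The random walk confined to a finite set\<close>

lemma mdist_translate_one:
  fixes G (structure)
  assumes "group G" "left_invariant_metric G \<rho>" "x \<in> carrier G" "w \<in> carrier G"
  shows "mdist \<rho> (x \<otimes> w) x = mdist \<rho> w \<one>"
proof -
  interpret group G by fact
  have "mdist \<rho> (x \<otimes> w) (x \<otimes> \<one>) = mdist \<rho> w \<one>"
    using assms unfolding left_invariant_metric_def by blast
  then show ?thesis using assms(3) by simp
qed

text \<open>Steps that would leave \<open>\<Omega>\<close> are replaced by a pause. Unlike conditioning on the walk staying inside,
  this keeps the uniform law on \<open>\<Omega>\<close> reversible.\<close>
definition confined_kernel ::
  "('a, 'm) monoid_scheme \<Rightarrow> 'a pmf \<Rightarrow> 'a set \<Rightarrow> 'a \<Rightarrow> 'a pmf" where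
  "confined_kernel G \<mu> \<Omega> x = map_pmf (\<lambda>g. if x \<otimes>\<^bsub>G\<^esub> g \<in> \<Omega> then x \<otimes>\<^bsub>G\<^esub> g else x) \<mu>"

text \<open>Pauses contribute only to the diagonal, so off the diagonal the kernel is that of the walk on
  the group.\<close>
lemma pmf_confined_kernel:
  fixes G (structure)
  assumes "group G" "set_pmf \<mu> \<subseteq> carrier G" "\<Omega> \<subseteq> carrier G" "x \<in> \<Omega>" "y \<in> \<Omega>" "x \<noteq> y"
  shows "pmf (confined_kernel G \<mu> \<Omega> x) y = pmf \<mu> (inv x \<otimes> y)"
proof -
  interpret group G by fact
  define \<phi> where "\<phi> = (\<lambda>g. if x \<otimes> g \<in> \<Omega> then x \<otimes> g else x)"
  have "\<phi> -` {y} \<inter> set_pmf \<mu> = {inv x \<otimes> y} \<inter> set_pmf \<mu>"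
  proof (rule Set.set_eqI)
    fix g
    have "x \<otimes> g = y \<longleftrightarrow> g = inv x \<otimes> y" if "g \<in> carrier G"
      using that assms by (metis inv_solve_left subsetD)
    then show "g \<in> \<phi> -` {y} \<inter> set_pmf \<mu> \<longleftrightarrow> g \<in> {inv x \<otimes> y} \<inter> set_pmf \<mu>"
      using assms unfolding \<phi>_def by (cases "g \<in> set_pmf \<mu>") (auto simp: subset_iff)
  qed
  then have "measure_pmf.prob \<mu> (\<phi> -` {y}) = measure_pmf.prob \<mu> {inv x \<otimes> y}"
    by (metis measure_Int_set_pmf)
  then show ?thesis
    unfolding confined_kernel_def \<phi>_def pmf_map by (simp add: measure_pmf_single)
qed

lemma confined_chain_reversible:
  fixes G (structure)
  assumes "group G" "symmetric_pmf_on G \<mu>" "finite \<Omega>" "\<Omega> \<subseteq> carrier G" "\<Omega> \<noteq> {}"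
  shows "stationary_reversible_chain \<Omega> (pmf_of_set \<Omega>) (confined_kernel G \<mu> \<Omega>)"
proof (rule detailed_balance_imp_stationary_reversible)
  interpret group G by fact
  have sub: "set_pmf \<mu> \<subseteq> carrier G" and sym: "\<And>g. g \<in> carrier G \<Longrightarrow> pmf \<mu> g = pmf \<mu> (inv g)"
    using assms(2) unfolding symmetric_pmf_on_def by blast+
  fix x y assume xy: "x \<in> \<Omega>" "y \<in> \<Omega>"
  have "pmf (confined_kernel G \<mu> \<Omega> x) y = pmf (confined_kernel G \<mu> \<Omega> y) x"
  proof (cases "x = y")
    case False
    have car: "x \<in> carrier G" "y \<in> carrier G" using xy assms by auto
    have "pmf \<mu> (inv x \<otimes> y) = pmf \<mu> (inv (inv x \<otimes> y))" using car by (intro sym) auto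
    also have "inv (inv x \<otimes> y) = inv y \<otimes> x" using car by (simp add: inv_mult_group)
    finally show ?thesis
      using pmf_confined_kernel[OF assms(1) sub assms(4)] xy False by simp
  qed simp
  then show "pmf (pmf_of_set \<Omega>) x * pmf (confined_kernel G \<mu> \<Omega> x) y =
      pmf (pmf_of_set \<Omega>) y * pmf (confined_kernel G \<mu> \<Omega> y) x"
    using assms xy by simp
qed (use assms in \<open>auto simp: confined_kernel_def\<close>)

lemma confined_chain_from_interior:
  fixes G (structure)
  assumes "group G" "set_pmf \<mu> \<subseteq> carrier G" "x \<in> carrier G"
    and int: "\<And>j w. j \<le> t \<Longrightarrow> w \<in> set_pmf (walk_pmf G \<mu> j) \<Longrightarrow> x \<otimes> w \<in> \<Omega>"
  shows "chain_from (confined_kernel G \<mu> \<Omega>) t x = map_pmf ((\<otimes>) x) (walk_pmf G \<mu> t)"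
  using int
proof (induction t)
  case 0
  interpret group G by fact
  show ?case using assms by simp
next
  case (Suc t)
  interpret group G by fact
  have "chain_from (confined_kernel G \<mu> \<Omega>) (Suc t) x
      = bind_pmf (walk_pmf G \<mu> t) (\<lambda>w. confined_kernel G \<mu> \<Omega> (x \<otimes> w))"
  proof -
    have "chain_from (confined_kernel G \<mu> \<Omega>) t x = map_pmf ((\<otimes>) x) (walk_pmf G \<mu> t)"
      by (rule Suc.IH, rule Suc.prems) auto
    then show ?thesis by (simp add: bind_map_pmf)
  qed
  also have "\<dots> = bind_pmf (walk_pmf G \<mu> t) (\<lambda>w. map_pmf (\<lambda>g. x \<otimes> (w \<otimes> g)) \<mu>)"
  proof (intro bind_pmf_cong refl)
    fix w assume w: "w \<in> set_pmf (walk_pmf G \<mu> t)"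
    then have wG: "w \<in> carrier G" using set_walk_pmf[OF assms(1,2)] by blast
    show "confined_kernel G \<mu> \<Omega> (x \<otimes> w) = map_pmf (\<lambda>g. x \<otimes> (w \<otimes> g)) \<mu>"
      unfolding confined_kernel_def
    proof (intro map_pmf_cong refl)
      fix g assume g: "g \<in> set_pmf \<mu>"
      have eq: "x \<otimes> w \<otimes> g = x \<otimes> (w \<otimes> g)" using g wG assms by (intro m_assoc) auto
      have "w \<otimes> g \<in> set_pmf (walk_pmf G \<mu> (Suc t))"
        using w g by (auto simp: walk_pmf_Suc_right[OF assms(1,2)])
      then show "(if x \<otimes> w \<otimes> g \<in> \<Omega> then x \<otimes> w \<otimes> g else x \<otimes> w) = x \<otimes> (w \<otimes> g)"
        using Suc.prems[of "Suc t"] by (simp add: eq)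
    qed
  qed
  also have "\<dots> = map_pmf ((\<otimes>) x) (walk_pmf G \<mu> (Suc t))"
    by (simp add: walk_pmf_Suc_right[OF assms(1,2)] map_bind_pmf map_pmf_comp)
  finally show ?case .
qed

lemma expectation_chain_joint_uniform:
  fixes h :: "'s \<Rightarrow> 's \<Rightarrow> real"
  assumes "finite S" "S \<noteq> {}" "\<And>x. x \<in> S \<Longrightarrow> set_pmf (a x) \<subseteq> S"
  shows "measure_pmf.expectation (chain_joint (pmf_of_set S) a t) (\<lambda>(x, y). h x y)
    = (\<Sum>x\<in>S. measure_pmf.expectation (chain_from a t x) (h x)) / card S"
proof -
  have "finite (set_pmf (chain_from a t x))" if "x \<in> S" for x
    using set_chain_from[of S a x t, OF assms(3) that] assms(1) by (rule finite_subset)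
  then show ?thesis
    unfolding chain_joint_def
    by (subst pmf_expectation_bind_pmf_of_set) (use assms in \<open>auto simp: divide_inverse_commute simp flip: sum_distrib_left\<close>)
qed

text \<open>Markov type is applied to the confined walk on the set \<open>\<Omega>\<close> from \<open>amenable_interior\<close>, for the set
  \<open>T\<close> of all positions that the walk can reach up to time \<open>t\<close>. One step of the confined walk moves
  at most as far as a step of the walk, whatever the starting point; for the lower bound at time \<open>t\<close>, it
  is enough to keep the starting points in \<open>F\<close>, where the two walks agree.\<close>
lemma finite_walk_displacement_bound:
  fixes G (structure) and X :: "'b metric"
  assumes am: "amenable_group G" and inv: "left_invariant_metric G \<rho>"
    and p: "0 \<le> p" and K: "\<And>n. markov_type_bound X p K {1..n::nat}"
    and f: "f \<in> carrier G \<rightarrow> mspace X"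
    and L: "0 \<le> L" "\<And>x y. x \<in> carrier G \<Longrightarrow> y \<in> carrier G \<Longrightarrow> mdist X (f x) (f y) \<le> L * mdist \<rho> x y"
    and c: "0 \<le> c" "\<And>x y. x \<in> carrier G \<Longrightarrow> y \<in> carrier G \<Longrightarrow> c * mdist \<rho> x y powr \<alpha> \<le> mdist X (f x) (f y)"
    and sym: "symmetric_pmf_on G \<mu>" and fin: "finite (set_pmf \<mu>)"
  shows "c powr p * measure_pmf.expectation (walk_pmf G \<mu> t) (\<lambda>w. mdist \<rho> w \<one> powr (\<alpha> * p))
    \<le> 2 * K powr p * L powr p * real t * measure_pmf.expectation \<mu> (\<lambda>g. mdist \<rho> g \<one> powr p)"
    (is "c powr p * ?W \<le> 2 * K powr p * L powr p * real t * ?E")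
proof -
  have grp: "group G" using am by (simp add: amenable_group_def)
  interpret group G by fact
  have sub: "set_pmf \<mu> \<subseteq> carrier G" using sym by (simp add: symmetric_pmf_on_def)
  define T where "T = (\<Union>j\<le>t. set_pmf (walk_pmf G \<mu> j))"
  have T: "finite T" "T \<subseteq> carrier G"
    using set_walk_pmf[OF grp sub] fin unfolding T_def by (auto intro: finite_set_walk_pmf)
  obtain F \<Omega> where \<Omega>: "finite \<Omega>" "\<Omega> \<subseteq> carrier G" and F: "F \<subseteq> carrier G" "finite F" "F \<noteq> {}"
    and int: "\<And>x w. x \<in> F \<Longrightarrow> w \<in> T \<Longrightarrow> x \<otimes> w \<in> \<Omega>" and card: "card \<Omega> \<le> 2 * card F"
    using amenable_interior[OF am T] by metis
  \<comment> \<open>The walk is at the identity at time 0, so the starting points themselves lie in \<open>\<Omega>\<close>.\<close>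
  have "\<one> \<in> T" unfolding T_def by (rule UN_I[of 0]) auto
  then have F\<Omega>: "F \<subseteq> \<Omega>" using int F(1) by (metis r_one subsetD subsetI)
  then have ne: "\<Omega> \<noteq> {}" using F(3) by blast
  define a where "a = confined_kernel G \<mu> \<Omega>"
  define D where "D = (\<lambda>s. measure_pmf.expectation (chain_joint (pmf_of_set \<Omega>) a s)
    (\<lambda>(x, y). mdist X (f y) (f x) powr p))"
  have aS: "set_pmf (a x) \<subseteq> \<Omega>" if "x \<in> \<Omega>" for x
    using that unfolding a_def confined_kernel_def by auto
  have D: "D s = (\<Sum>x\<in>\<Omega>. measure_pmf.expectation (chain_from a s x)
      (\<lambda>y. mdist X (f y) (f x) powr p)) / card \<Omega>" for s
    unfolding D_def using expectation_chain_joint_uniform[OF \<Omega>(1) ne aS] .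
  have "stationary_reversible_chain \<Omega> (pmf_of_set \<Omega>) a"
    unfolding a_def by (rule confined_chain_reversible[OF grp sym \<Omega> ne])
  moreover have "f \<in> \<Omega> \<rightarrow> mspace X" using f \<Omega> by auto
  ultimately have mt: "D t \<le> K powr p * real t * D 1"
    using markov_type_bound_finite[OF K \<Omega>(1)] unfolding markov_type_bound_def D_def by blast
  have "D 1 \<le> L powr p * ?E"
  proof -
    have "measure_pmf.expectation (chain_from a 1 x) (\<lambda>y. mdist X (f y) (f x) powr p)
        \<le> L powr p * ?E" if x: "x \<in> \<Omega>" for x
    proof -
      have "measure_pmf.expectation (chain_from a 1 x) (\<lambda>y. mdist X (f y) (f x) powr p)
          = measure_pmf.expectation \<mu> (\<lambda>g. mdist X (f (if x \<otimes> g \<in> \<Omega> then x \<otimes> g else x)) (f x) powr p)"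
        by (simp add: a_def confined_kernel_def bind_return_pmf)
      also have "\<dots> \<le> measure_pmf.expectation \<mu> (\<lambda>g. L powr p * mdist \<rho> g \<one> powr p)"
      proof (intro integral_mono_AE integrable_measure_pmf_finite fin)
        have "mdist X (f (if x \<otimes> g \<in> \<Omega> then x \<otimes> g else x)) (f x) powr p
            \<le> L powr p * mdist \<rho> g \<one> powr p" if g: "g \<in> set_pmf \<mu>" for g
        proof -
          have car: "x \<in> carrier G" "g \<in> carrier G" using x \<Omega> g sub by auto
          have "mdist X (f (x \<otimes> g)) (f x) \<le> L * mdist \<rho> g \<one>"
            using L(2)[of "x \<otimes> g" x] car by (simp add: mdist_translate_one[OF grp inv])
          moreover have "mdist X (f x) (f x) = 0" using f car by (auto simp: Pi_iff)
          moreover have "0 \<le> L * mdist \<rho> g \<one>" using L(1) by simp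
          ultimately have "mdist X (f (if x \<otimes> g \<in> \<Omega> then x \<otimes> g else x)) (f x) \<le> L * mdist \<rho> g \<one>"
            by simp
          then show ?thesis
            using L(1) p by (metis powr_mono2 powr_mult mdist_nonneg)
        qed
        then show "AE g in \<mu>. mdist X (f (if x \<otimes> g \<in> \<Omega> then x \<otimes> g else x)) (f x) powr p
            \<le> L powr p * mdist \<rho> g \<one> powr p"
          by (simp add: AE_measure_pmf_iff)
      qed
      finally show ?thesis by simp
    qed
    then have "(\<Sum>x\<in>\<Omega>. measure_pmf.expectation (chain_from a 1 x)
        (\<lambda>y. mdist X (f y) (f x) powr p)) \<le> real (card \<Omega>) * (L powr p * ?E)"
      by (rule sum_bounded_above)
    moreover have "0 < real (card \<Omega>)" using ne \<Omega> by (simp add: card_gt_0_iff)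
    ultimately show ?thesis unfolding D by (simp add: divide_le_eq mult.commute)
  qed
  then have up: "D t \<le> K powr p * real t * (L powr p * ?E)"
    using mt by (meson mult_left_mono mult_nonneg_nonneg of_nat_0_le_iff order_trans powr_ge_zero)
  have fint: "finite (set_pmf (walk_pmf G \<mu> t))" using fin by (rule finite_set_walk_pmf)
  have low: "c powr p * ?W \<le> measure_pmf.expectation (chain_from a t x) (\<lambda>y. mdist X (f y) (f x) powr p)"
    if x: "x \<in> F" for x
  proof -
    have xG: "x \<in> carrier G" using x F by blast
    have "chain_from a t x = map_pmf ((\<otimes>) x) (walk_pmf G \<mu> t)"
      unfolding a_def using int[OF x] xG
      by (intro confined_chain_from_interior[OF grp sub]) (auto simp: T_def)
    moreover have "c powr p * ?W \<le> measure_pmf.expectation (walk_pmf G \<mu> t)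
        (\<lambda>w. mdist X (f (x \<otimes> w)) (f x) powr p)"
      unfolding integral_mult_right_zero[symmetric]
    proof (intro integral_mono_AE integrable_measure_pmf_finite fint)
      have "c powr p * mdist \<rho> w \<one> powr (\<alpha> * p) \<le> mdist X (f (x \<otimes> w)) (f x) powr p"
        if w: "w \<in> set_pmf (walk_pmf G \<mu> t)" for w
      proof -
        have wG: "w \<in> carrier G" using w set_walk_pmf[OF grp sub] by blast
        have "c * mdist \<rho> w \<one> powr \<alpha> \<le> mdist X (f (x \<otimes> w)) (f x)"
          using c(2)[of "x \<otimes> w" x] xG wG by (simp add: mdist_translate_one[OF grp inv])
        then have "(c * mdist \<rho> w \<one> powr \<alpha>) powr p \<le> mdist X (f (x \<otimes> w)) (f x) powr p"
          using c(1) p by (intro powr_mono2) auto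
        then show ?thesis using c(1) by (simp add: powr_mult powr_powr)
      qed
      then show "AE w in walk_pmf G \<mu> t. c powr p * mdist \<rho> w \<one> powr (\<alpha> * p)
          \<le> mdist X (f (x \<otimes> w)) (f x) powr p"
        by (simp add: AE_measure_pmf_iff)
    qed
    ultimately show ?thesis by simp
  qed
  have "real (card F) * (c powr p * ?W) \<le> (\<Sum>x\<in>F. measure_pmf.expectation (chain_from a t x)
      (\<lambda>y. mdist X (f y) (f x) powr p))"
    using low by (rule sum_bounded_below)
  also have "\<dots> \<le> (\<Sum>x\<in>\<Omega>. measure_pmf.expectation (chain_from a t x)
      (\<lambda>y. mdist X (f y) (f x) powr p))"
    using \<Omega>(1) F\<Omega> by (intro sum_mono2) auto
  also have "\<dots> = real (card \<Omega>) * D t"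
    unfolding D using ne \<Omega> by simp
  also have "\<dots> \<le> real (2 * card F) * D t"
  proof (intro mult_right_mono of_nat_mono card)
    show "0 \<le> D t" unfolding D_def by (intro integral_nonneg_AE) (auto split: prod.split)
  qed
  finally have "real (card F) * (c powr p * ?W) \<le> real (card F) * (2 * D t)" by simp
  then have "c powr p * ?W \<le> 2 * D t"
    using F by (simp add: card_gt_0_iff)
  then show ?thesis using up by (simp add: mult.assoc mult.left_commute)
qed

section \<open>Step laws of unbounded support\<close>

lemma map_inv_eq_imp_symmetric:
  fixes G (structure)
  assumes "group G" "set_pmf \<mu> \<subseteq> carrier G" "map_pmf (m_inv G) \<mu> = \<mu>"
  shows "symmetric_pmf_on G \<mu>"
  unfolding symmetric_pmf_on_def
proof (intro conjI ballI assms)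
  interpret group G by fact
  fix g assume g: "g \<in> carrier G"
  have "inj_on (m_inv G) (carrier G)" by (intro inj_onI) (metis inv_inv)
  then show "pmf \<mu> g = pmf \<mu> (inv g)"
    using pmf_map_inj_on[of "m_inv G" "carrier G" \<mu> g] assms g by simp
qed

lemma symmetric_imp_map_inv_eq:
  fixes G (structure)
  assumes "group G" "symmetric_pmf_on G \<mu>"
  shows "map_pmf (m_inv G) \<mu> = \<mu>"
proof (rule pmf_eqI)
  interpret group G by fact
  have sub: "set_pmf \<mu> \<subseteq> carrier G" and sym: "\<And>g. g \<in> carrier G \<Longrightarrow> pmf \<mu> g = pmf \<mu> (inv g)"
    using assms(2) unfolding symmetric_pmf_on_def by blast+
  have inj: "inj_on (m_inv G) (carrier G)" by (intro inj_onI) (metis inv_inv)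
  fix g
  show "pmf (map_pmf (m_inv G) \<mu>) g = pmf \<mu> g"
  proof (cases "g \<in> carrier G")
    case True
    then show ?thesis
      using pmf_map_inj_on[OF inj sub, of "inv g"] sym[of g] by simp
  next
    case False
    then have "g \<notin> set_pmf \<mu>" "g \<notin> set_pmf (map_pmf (m_inv G) \<mu>)" using sub by auto
    then show ?thesis by (metis pmf_eq_0_set_pmf)
  qed
qed

lemma mdist_inv_one:
  fixes G (structure)
  assumes "group G" "left_invariant_metric G \<rho>" "g \<in> carrier G"
  shows "mdist \<rho> (inv g) \<one> = mdist \<rho> g \<one>"
proof -
  interpret group G by fact
  have "mdist \<rho> g \<one> = mdist \<rho> (g \<otimes> inv g) g" using assms by (simp add: mdist_commute)
  then show ?thesis using mdist_translate_one[OF assms(1,2,3), of "inv g"] assms by simp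
qed

text \<open>Truncating the steps of the walk and truncating its step law are the same.\<close>
lemma replicate_pmf_map: "replicate_pmf n (map_pmf f p) = map_pmf (map f) (replicate_pmf n p)"
  by (induction n) (simp_all add: map_pmf_def bind_assoc_pmf bind_return_pmf)

definition truncate_step :: "('a, 'm) monoid_scheme \<Rightarrow> 'a metric \<Rightarrow> nat \<Rightarrow> 'a \<Rightarrow> 'a" where
  "truncate_step G \<rho> n g = (if mdist \<rho> g \<one>\<^bsub>G\<^esub> \<le> real n then g else \<one>\<^bsub>G\<^esub>)"

lemma symmetric_truncate_step:
  fixes G (structure)
  assumes "group G" "left_invariant_metric G \<rho>" "symmetric_pmf_on G \<mu>"
  shows "symmetric_pmf_on G (map_pmf (truncate_step G \<rho> n) \<mu>)"
proof (rule map_inv_eq_imp_symmetric)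
  interpret group G by fact
  have sub: "set_pmf \<mu> \<subseteq> carrier G" using assms(3) by (simp add: symmetric_pmf_on_def)
  then show "set_pmf (map_pmf (truncate_step G \<rho> n) \<mu>) \<subseteq> carrier G"
    by (auto simp: truncate_step_def)
  have "map_pmf (m_inv G) (map_pmf (truncate_step G \<rho> n) \<mu>)
      = map_pmf (truncate_step G \<rho> n) (map_pmf (m_inv G) \<mu>)"
    unfolding map_pmf_comp using sub
    by (intro map_pmf_cong refl) (auto simp: truncate_step_def mdist_inv_one[OF assms(1,2)] subset_iff)
  then show "map_pmf (m_inv G) (map_pmf (truncate_step G \<rho> n) \<mu>) = map_pmf (truncate_step G \<rho> n) \<mu>"
    by (simp add: symmetric_imp_map_inv_eq[OF assms(1,3)])
qed fact

text \<open>Realise all truncated walks on one space of step sequences. A finite sequence of steps is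
  unchanged by truncation at large \<open>n\<close>, so the integrands converge pointwise and Fatou's lemma applies.\<close>
lemma nn_integral_walk_le_truncated:
  fixes G (structure) and h :: "'a \<Rightarrow> ennreal"
  assumes "\<And>n. (\<integral>\<^sup>+w. h w \<partial>walk_pmf G (map_pmf (truncate_step G \<rho> n) \<mu>) t) \<le> B"
  shows "(\<integral>\<^sup>+w. h w \<partial>walk_pmf G \<mu> t) \<le> B"
proof -
  define P where "P = (\<lambda>gs. foldr (\<otimes>) gs \<one>)"
  define \<tau> where "\<tau> = truncate_step G \<rho>"
  have stable: "\<forall>\<^sub>F n in sequentially. map (\<tau> n) gs = gs" for gs
  proof (induction gs)
    case (Cons g gs)
    have "\<forall>\<^sub>F n in sequentially. \<tau> n g = g"
      using eventually_ge_at_top[of "nat \<lceil>mdist \<rho> g \<one>\<rceil>"]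
      by eventually_elim (auto simp: \<tau>_def truncate_step_def nat_le_iff ceiling_le_iff)
    with Cons show ?case by eventually_elim simp
  qed simp
  have lim: "liminf (\<lambda>n. h (P (map (\<tau> n) gs))) = h (P gs)" for gs
    by (intro lim_imp_Liminf tendsto_eventually trivial_limit_sequentially
        eventually_mono[OF stable[of gs]]) simp
  have "(\<integral>\<^sup>+w. h w \<partial>walk_pmf G \<mu> t)
      = (\<integral>\<^sup>+gs. liminf (\<lambda>n. h (P (map (\<tau> n) gs))) \<partial>replicate_pmf t \<mu>)"
    unfolding lim by (simp add: walk_pmf_def P_def)
  also have "\<dots> \<le> liminf (\<lambda>n. \<integral>\<^sup>+gs. h (P (map (\<tau> n) gs)) \<partial>replicate_pmf t \<mu>)"
    by (rule nn_integral_liminf) simp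
  also have "\<dots> \<le> liminf (\<lambda>n. B)"
    using assms by (intro Liminf_mono always_eventually)
      (simp add: walk_pmf_def replicate_pmf_map P_def \<tau>_def)
  also have "\<dots> = B" by (rule Liminf_const) simp
  finally show ?thesis .
qed

text \<open>Truncation only decreases the \<open>p\<close>-th moment of a step, so the bound for the truncated laws is
  uniform in the truncation, and it passes to the limit.\<close>
lemma walk_displacement_bound:
  fixes G (structure) and X :: "'b metric"
  assumes am: "amenable_group G" and inv: "left_invariant_metric G \<rho>"
    and ball: "\<And>r. 0 \<le> r \<Longrightarrow> finite {x \<in> carrier G. mdist \<rho> x \<one> \<le> r}"
    and p: "0 \<le> p" and K: "\<And>n. markov_type_bound X p K {1..n::nat}"
    and f: "f \<in> carrier G \<rightarrow> mspace X"
    and L: "0 \<le> L" "\<And>x y. x \<in> carrier G \<Longrightarrow> y \<in> carrier G \<Longrightarrow> mdist X (f x) (f y) \<le> L * mdist \<rho> x y"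
    and c: "0 < c" "\<And>x y. x \<in> carrier G \<Longrightarrow> y \<in> carrier G \<Longrightarrow> c * mdist \<rho> x y powr \<alpha> \<le> mdist X (f x) (f y)"
    and sym: "symmetric_pmf_on G \<mu>" and int: "integrable \<mu> (\<lambda>g. mdist \<rho> g \<one> powr p)"
  shows "(\<integral>\<^sup>+w. ennreal (mdist \<rho> w \<one> powr (\<alpha> * p)) \<partial>walk_pmf G \<mu> t)
    \<le> ennreal (2 * K powr p * L powr p / c powr p *
        (real t * measure_pmf.expectation \<mu> (\<lambda>g. mdist \<rho> g \<one> powr p)))"
proof (rule nn_integral_walk_le_truncated)
  fix n
  have grp: "group G" using am by (simp add: amenable_group_def)
  interpret group G by fact
  have mG: "mspace \<rho> = carrier G" using inv by (simp add: left_invariant_metric_def)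
  have d1: "mdist \<rho> \<one> \<one> = 0" by (simp add: mG)
  define \<mu>' where "\<mu>' = map_pmf (truncate_step G \<rho> n) \<mu>"
  have sub: "set_pmf \<mu> \<subseteq> carrier G" using sym by (simp add: symmetric_pmf_on_def)
  have "set_pmf \<mu>' \<subseteq> {x \<in> carrier G. mdist \<rho> x \<one> \<le> real n}"
    using sub d1 unfolding \<mu>'_def truncate_step_def by auto
  then have fin: "finite (set_pmf \<mu>')" using ball[of "real n"] by (meson finite_subset of_nat_0_le_iff)
  have sym': "symmetric_pmf_on G \<mu>'"
    unfolding \<mu>'_def by (rule symmetric_truncate_step[OF grp inv sym])
  have "measure_pmf.expectation \<mu>' (\<lambda>g. mdist \<rho> g \<one> powr p)
      = measure_pmf.expectation \<mu> (\<lambda>g. mdist \<rho> (truncate_step G \<rho> n g) \<one> powr p)"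
    unfolding \<mu>'_def by simp
  also have "\<dots> \<le> measure_pmf.expectation \<mu> (\<lambda>g. mdist \<rho> g \<one> powr p)"
  proof (rule integral_mono)
    show le: "mdist \<rho> (truncate_step G \<rho> n g) \<one> powr p \<le> mdist \<rho> g \<one> powr p" for g
      using d1 by (auto simp: truncate_step_def)
    show "integrable \<mu> (\<lambda>g. mdist \<rho> (truncate_step G \<rho> n g) \<one> powr p)"
      by (rule Bochner_Integration.integrable_bound[OF int]) (use le in auto)
  qed fact
  finally have E: "measure_pmf.expectation \<mu>' (\<lambda>g. mdist \<rho> g \<one> powr p)
      \<le> measure_pmf.expectation \<mu> (\<lambda>g. mdist \<rho> g \<one> powr p)" .
  have "c powr p * measure_pmf.expectation (walk_pmf G \<mu>' t) (\<lambda>w. mdist \<rho> w \<one> powr (\<alpha> * p))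
      \<le> 2 * K powr p * L powr p * real t * measure_pmf.expectation \<mu>' (\<lambda>g. mdist \<rho> g \<one> powr p)"
    by (rule finite_walk_displacement_bound[OF am inv p K f L less_imp_le[OF c(1)] c(2) sym' fin])
  also have "\<dots> \<le> 2 * K powr p * L powr p * real t * measure_pmf.expectation \<mu> (\<lambda>g. mdist \<rho> g \<one> powr p)"
    using E by (intro mult_left_mono) auto
  finally have "measure_pmf.expectation (walk_pmf G \<mu>' t) (\<lambda>w. mdist \<rho> w \<one> powr (\<alpha> * p))
      \<le> 2 * K powr p * L powr p / c powr p *
        (real t * measure_pmf.expectation \<mu> (\<lambda>g. mdist \<rho> g \<one> powr p))"
    using c(1) by (simp add: field_simps)
  moreover have "(\<integral>\<^sup>+w. ennreal (mdist \<rho> w \<one> powr (\<alpha> * p)) \<partial>walk_pmf G \<mu>' t)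
      = ennreal (measure_pmf.expectation (walk_pmf G \<mu>' t) (\<lambda>w. mdist \<rho> w \<one> powr (\<alpha> * p)))"
    using fin by (intro nn_integral_eq_integral integrable_measure_pmf_finite finite_set_walk_pmf) auto
  ultimately show "(\<integral>\<^sup>+w. ennreal (mdist \<rho> w \<one> powr (\<alpha> * p)) \<partial>walk_pmf G \<mu>' t)
    \<le> ennreal (2 * K powr p * L powr p / c powr p *
        (real t * measure_pmf.expectation \<mu> (\<lambda>g. mdist \<rho> g \<one> powr p)))"
    by (simp add: ennreal_leI)
qed

section \<open>First moments of the walk\<close>

text \<open>The unit ball is finite, so among its points other than the identity, if there are any, one is nearest to it.\<close>
lemma identity_isolated:
  fixes G (structure)
  assumes "group G" "left_invariant_metric G \<rho>"
    and ball: "\<And>r. 0 \<le> r \<Longrightarrow> finite {x \<in> carrier G. mdist \<rho> x \<one> \<le> r}"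
  obtains \<delta> where "0 < \<delta>" "\<And>g. g \<in> carrier G \<Longrightarrow> g \<noteq> \<one> \<Longrightarrow> \<delta> \<le> mdist \<rho> g \<one>"
proof -
  interpret group G by fact
  have mG: "mspace \<rho> = carrier G" using assms(2) by (simp add: left_invariant_metric_def)
  define D where "D = insert 1 ((\<lambda>x. mdist \<rho> x \<one>) ` ({x \<in> carrier G. mdist \<rho> x \<one> \<le> 1} - {\<one>}))"
  have fin: "finite D" using ball[of 1] unfolding D_def by simp
  have "0 < d" if "d \<in> D" for d
    using that mG unfolding D_def by (auto simp: less_le)
  then have "0 < Min D" using fin by (subst Min_gr_iff) (auto simp: D_def)
  moreover have "Min D \<le> mdist \<rho> g \<one>" if "g \<in> carrier G" "g \<noteq> \<one>" for g
  proof (cases "mdist \<rho> g \<one> \<le> 1")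
    case True
    then show ?thesis using that fin by (intro Min_le) (auto simp: D_def)
  next
    case False
    moreover have "Min D \<le> 1" using fin by (intro Min_le) (auto simp: D_def)
    ultimately show ?thesis by simp
  qed
  ultimately show thesis by (rule that)
qed

lemma walk_mean_subadditive:
  fixes G (structure)
  assumes grp: "group G" and inv: "left_invariant_metric G \<rho>" and sub: "set_pmf \<mu> \<subseteq> carrier G"
  shows "(\<integral>\<^sup>+w. ennreal (mdist \<rho> w \<one>) \<partial>walk_pmf G \<mu> t) \<le> of_nat t * (\<integral>\<^sup>+g. ennreal (mdist \<rho> g \<one>) \<partial>\<mu>)"
proof (induction t)
  case 0
  interpret group G by fact
  show ?case using inv by (simp add: left_invariant_metric_def)
next
  case (Suc t)
  interpret group G by fact
  define I where "I = (\<integral>\<^sup>+g. ennreal (mdist \<rho> g \<one>) \<partial>\<mu>)"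
  have mG: "mspace \<rho> = carrier G" using inv by (simp add: left_invariant_metric_def)
  have "(\<integral>\<^sup>+w. ennreal (mdist \<rho> w \<one>) \<partial>walk_pmf G \<mu> (Suc t))
      = (\<integral>\<^sup>+g. \<integral>\<^sup>+w. ennreal (mdist \<rho> (g \<otimes> w) \<one>) \<partial>walk_pmf G \<mu> t \<partial>\<mu>)"
    by (simp add: walk_pmf_Suc nn_integral_bind_pmf)
  also have "\<dots> \<le> (\<integral>\<^sup>+g. \<integral>\<^sup>+w. ennreal (mdist \<rho> g \<one>) + ennreal (mdist \<rho> w \<one>) \<partial>walk_pmf G \<mu> t \<partial>\<mu>)"
  proof (intro nn_integral_mono_AE, unfold AE_measure_pmf_iff, intro ballI nn_integral_mono_AE, unfold AE_measure_pmf_iff, intro ballI)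
    fix g w assume "g \<in> set_pmf \<mu>" "w \<in> set_pmf (walk_pmf G \<mu> t)"
    then have car: "g \<in> carrier G" "w \<in> carrier G" using sub set_walk_pmf[OF grp sub] by auto
    then have "mdist \<rho> (g \<otimes> w) \<one> \<le> mdist \<rho> (g \<otimes> w) g + mdist \<rho> g \<one>"
      by (intro mdist_triangle) (auto simp: mG)
    then have "mdist \<rho> (g \<otimes> w) \<one> \<le> mdist \<rho> g \<one> + mdist \<rho> w \<one>"
      by (simp add: mdist_translate_one[OF grp inv car])
    then show "ennreal (mdist \<rho> (g \<otimes> w) \<one>) \<le> ennreal (mdist \<rho> g \<one>) + ennreal (mdist \<rho> w \<one>)"
      by (simp add: ennreal_leI flip: ennreal_plus)
  qed
  also have "\<dots> = I + (\<integral>\<^sup>+w. ennreal (mdist \<rho> w \<one>) \<partial>walk_pmf G \<mu> t)"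
    by (simp add: nn_integral_add measure_pmf.emeasure_space_1 I_def)
  also have "\<dots> \<le> I + of_nat t * I"
    using Suc unfolding I_def by (intro add_left_mono)
  also have "\<dots> = of_nat (Suc t) * I" by (simp add: algebra_simps)
  finally show ?case unfolding I_def .
qed

text \<open>The expected displacement at time \<open>t\<close> is controlled by the power \<open>\<gamma>\<close> of the quantity whose logarithm is
  the denominator in \<open>\<beta>\<^sub>p\<^sup>*\<close>. The constant does not depend on the step law, as the law
  varies with \<open>t\<close> in an admissible sequence.\<close>
definition walk_mean_growth :: "('a, 'm) monoid_scheme \<Rightarrow> 'a metric \<Rightarrow> real \<Rightarrow> real \<Rightarrow> bool" where
  "walk_mean_growth G \<rho> p \<gamma> \<longleftrightarrow> (\<exists>C>0. \<forall>\<mu> t.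
     symmetric_pmf_on G \<mu> \<longrightarrow> integrable \<mu> (\<lambda>g. mdist \<rho> g \<one>\<^bsub>G\<^esub> powr p) \<longrightarrow>
     0 < real t * measure_pmf.expectation \<mu> (\<lambda>g. mdist \<rho> g \<one>\<^bsub>G\<^esub> powr p) \<longrightarrow>
     measure_pmf.expectation (walk_pmf G \<mu> t) (\<lambda>w. mdist \<rho> w \<one>\<^bsub>G\<^esub>)
       \<le> C * (real t * measure_pmf.expectation \<mu> (\<lambda>g. mdist \<rho> g \<one>\<^bsub>G\<^esub> powr p)) powr \<gamma>)"

text \<open>The walk's mean displacement grows at most linearly in \<open>t\<close>, and the first moment of a step
  is controlled by the \<open>p\<close>-th because there are no arbitrarily short steps.\<close>
lemma walk_mean_growth_linear:
  fixes G (structure)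
  assumes grp: "group G" and inv: "left_invariant_metric G \<rho>"
    and ball: "\<And>r. 0 \<le> r \<Longrightarrow> finite {x \<in> carrier G. mdist \<rho> x \<one> \<le> r}" and p: "1 \<le> p"
  shows "walk_mean_growth G \<rho> p 1"
proof -
  interpret group G by fact
  have mG: "mspace \<rho> = carrier G" using inv by (simp add: left_invariant_metric_def)
  have d1: "mdist \<rho> \<one> \<one> = 0" by (simp add: mG)
  obtain \<delta> where \<delta>: "0 < \<delta>" "\<And>g. g \<in> carrier G \<Longrightarrow> g \<noteq> \<one> \<Longrightarrow> \<delta> \<le> mdist \<rho> g \<one>"
    using identity_isolated[OF grp inv ball] by metis
  have pw: "mdist \<rho> g \<one> \<le> \<delta> powr (1 - p) * mdist \<rho> g \<one> powr p" if g: "g \<in> carrier G" for g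
  proof (cases "g = \<one>")
    case False
    then have d: "0 < mdist \<rho> g \<one>" using \<delta> g by force
    have "mdist \<rho> g \<one> = mdist \<rho> g \<one> powr (1 - p) * mdist \<rho> g \<one> powr p"
      using d by (simp flip: powr_add)
    also have "\<dots> \<le> \<delta> powr (1 - p) * mdist \<rho> g \<one> powr p"
      using \<delta> False g p by (intro mult_right_mono powr_mono2') auto
    finally show ?thesis .
  qed (use d1 in simp)
  show ?thesis
    unfolding walk_mean_growth_def
  proof (intro exI[of _ "\<delta> powr (1 - p)"] conjI allI impI)
    show "0 < \<delta> powr (1 - p)" using \<delta> by simp
    fix \<mu> t
    assume sym: "symmetric_pmf_on G \<mu>" and int: "integrable \<mu> (\<lambda>g. mdist \<rho> g \<one> powr p)"
    define E where "E = measure_pmf.expectation \<mu> (\<lambda>g. mdist \<rho> g \<one> powr p)"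
    assume "0 < real t * measure_pmf.expectation \<mu> (\<lambda>g. mdist \<rho> g \<one> powr p)"
    then have pos: "0 < real t * E" unfolding E_def .
    have sub: "set_pmf \<mu> \<subseteq> carrier G" using sym by (simp add: symmetric_pmf_on_def)
    have "(\<integral>\<^sup>+g. ennreal (mdist \<rho> g \<one>) \<partial>\<mu>)
        \<le> (\<integral>\<^sup>+g. ennreal (\<delta> powr (1 - p) * mdist \<rho> g \<one> powr p) \<partial>\<mu>)"
      using sub pw by (intro nn_integral_mono_AE) (auto simp: AE_measure_pmf_iff intro!: ennreal_leI)
    also have "\<dots> = ennreal (\<delta> powr (1 - p) * E)"
      using int unfolding E_def by (subst nn_integral_eq_integral) auto
    finally have "(\<integral>\<^sup>+w. ennreal (mdist \<rho> w \<one>) \<partial>walk_pmf G \<mu> t) \<le> of_nat t * ennreal (\<delta> powr (1 - p) * E)"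
      using walk_mean_subadditive[OF grp inv sub, of t] by (meson mult_left_mono order_trans zero_le)
    also have "\<dots> = ennreal (\<delta> powr (1 - p) * (real t * E))"
      by (simp add: ennreal_of_nat_eq_real_of_nat algebra_simps flip: ennreal_mult')
    finally show "measure_pmf.expectation (walk_pmf G \<mu> t) (\<lambda>w. mdist \<rho> w \<one>)
        \<le> \<delta> powr (1 - p) * (real t * measure_pmf.expectation \<mu> (\<lambda>g. mdist \<rho> g \<one> powr p)) powr 1"
      using pos unfolding E_def[symmetric] by (intro integral_real_bounded) auto
  qed
qed

text \<open>A form of Young's inequality that replaces Jensen's: integrated, it bounds a first moment
  by a \<open>q\<close>-th moment, and it also shows that the first moment is finite.\<close>
lemma le_add_scaled_powr:
  fixes x M q :: real
  assumes "0 \<le> x" "0 < M" "1 \<le> q"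
  shows "x \<le> M + M powr (1 - q) * x powr q"
proof (cases "x \<le> M")
  case False
  then have "x = x powr (1 - q) * x powr q" using assms by (simp flip: powr_add)
  also have "\<dots> \<le> M powr (1 - q) * x powr q"
    using False assms by (intro mult_right_mono powr_mono2') auto
  finally show ?thesis using assms by simp
qed (simp add: add_increasing2)

lemma walk_mean_growth_from_compression:
  fixes G (structure) and X :: "'b metric"
  assumes am: "amenable_group G" and inv: "left_invariant_metric G \<rho>"
    and ball: "\<And>r. 0 \<le> r \<Longrightarrow> finite {x \<in> carrier G. mdist \<rho> x \<one> \<le> r}"
    and p: "0 \<le> p" and K: "\<And>n. markov_type_bound X p K {1..n::nat}"
    and f: "f \<in> carrier G \<rightarrow> mspace X"
    and L: "0 \<le> L" "\<And>x y. x \<in> carrier G \<Longrightarrow> y \<in> carrier G \<Longrightarrow> mdist X (f x) (f y) \<le> L * mdist \<rho> x y"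
    and c: "0 < c" "\<And>x y. x \<in> carrier G \<Longrightarrow> y \<in> carrier G \<Longrightarrow> c * mdist \<rho> x y powr \<alpha> \<le> mdist X (f x) (f y)"
    and q: "1 \<le> \<alpha> * p"
  shows "walk_mean_growth G \<rho> p (1 / (\<alpha> * p))"
  unfolding walk_mean_growth_def
proof (intro exI conjI allI impI)
  define C where "C = 2 * K powr p * L powr p / c powr p"
  define q where "q = \<alpha> * p"
  have q1: "1 \<le> q" using q unfolding q_def .
  have C: "0 \<le> C" unfolding C_def by simp
  then show "0 < 1 + C" by simp
  fix \<mu> t
  assume sym: "symmetric_pmf_on G \<mu>" and int: "integrable \<mu> (\<lambda>g. mdist \<rho> g \<one> powr p)"
  define s where "s = real t * measure_pmf.expectation \<mu> (\<lambda>g. mdist \<rho> g \<one> powr p)"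
  assume "0 < real t * measure_pmf.expectation \<mu> (\<lambda>g. mdist \<rho> g \<one> powr p)"
  then have s: "0 < s" unfolding s_def .
  \<comment> \<open>At this scale both terms of the inequality are of the order \<open>M\<close>.\<close>
  define M where "M = s powr (1 / q)"
  have M: "0 < M" using s unfolding M_def by simp
  have "M powr (1 - q) * s = s powr ((1 / q) * (1 - q) + 1)"
    using s unfolding M_def by (simp add: powr_powr powr_add)
  also have "(1 / q) * (1 - q) + 1 = 1 / q" using q1 by (simp add: field_simps)
  finally have Ms: "M powr (1 - q) * s = M" unfolding M_def .
  have "(\<integral>\<^sup>+w. ennreal (mdist \<rho> w \<one>) \<partial>walk_pmf G \<mu> t)
      \<le> (\<integral>\<^sup>+w. ennreal M + ennreal (M powr (1 - q)) * ennreal (mdist \<rho> w \<one> powr q) \<partial>walk_pmf G \<mu> t)"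
  proof (rule nn_integral_mono)
    fix w
    have "ennreal (mdist \<rho> w \<one>) \<le> ennreal (M + M powr (1 - q) * mdist \<rho> w \<one> powr q)"
      using le_add_scaled_powr[OF _ M q1] by (intro ennreal_leI) simp
    then show "ennreal (mdist \<rho> w \<one>) \<le> ennreal M + ennreal (M powr (1 - q)) * ennreal (mdist \<rho> w \<one> powr q)"
      using M by (simp add: ennreal_mult)
  qed
  also have "\<dots> = ennreal M + ennreal (M powr (1 - q)) * (\<integral>\<^sup>+w. ennreal (mdist \<rho> w \<one> powr q) \<partial>walk_pmf G \<mu> t)"
    by (simp add: nn_integral_add nn_integral_cmult measure_pmf.emeasure_space_1)
  also have "\<dots> \<le> ennreal M + ennreal (M powr (1 - q)) * ennreal (C * s)"
    using walk_displacement_bound[OF am inv ball p K f L c sym int, of t]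
    unfolding C_def s_def q_def by (intro add_left_mono mult_left_mono) auto
  also have "\<dots> = ennreal (M + C * (M powr (1 - q) * s))"
    using M C s by (simp add: algebra_simps flip: ennreal_mult ennreal_plus)
  also have "\<dots> = ennreal ((1 + C) * M)" unfolding Ms by (simp add: algebra_simps)
  finally have "measure_pmf.expectation (walk_pmf G \<mu> t) (\<lambda>w. mdist \<rho> w \<one>) \<le> (1 + C) * M"
    using C M by (intro integral_real_bounded) auto
  then show "measure_pmf.expectation (walk_pmf G \<mu> t) (\<lambda>w. mdist \<rho> w \<one>) \<le> (1 + C) *
      (real t * measure_pmf.expectation \<mu> (\<lambda>g. mdist \<rho> g \<one> powr p)) powr (1 / (\<alpha> * p))"
    unfolding M_def s_def q_def .
qed

section \<open>Bounds for the parameter beta\<close>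

text \<open>The denominator tends to infinity because balls are finite: each step
  other than the identity has length at least \<open>\<delta>\<close>, and the expected number of such steps up to time \<open>t\<close> tends to
  infinity. The constant of \<open>walk_mean_growth\<close> then disappears in the quotient of logarithms.\<close>
lemma beta_star_seq_le:
  fixes G (structure)
  assumes grp: "group G" and inv: "left_invariant_metric G \<rho>"
    and ball: "\<And>r. 0 \<le> r \<Longrightarrow> finite {x \<in> carrier G. mdist \<rho> x \<one> \<le> r}" and p: "0 \<le> p"
    and gr: "walk_mean_growth G \<rho> p \<gamma>" and adm: "admissible_seq G \<rho> p \<mu>"
  shows "beta_star_seq G \<rho> p \<mu> \<le> ereal \<gamma>"
proof -
  interpret group G by fact
  obtain \<delta> where \<delta>: "0 < \<delta>" "\<And>g. g \<in> carrier G \<Longrightarrow> g \<noteq> \<one> \<Longrightarrow> \<delta> \<le> mdist \<rho> g \<one>"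
    using identity_isolated[OF grp inv ball] by metis
  define s where "s = (\<lambda>t. real t * measure_pmf.expectation (walk_pmf G (\<mu> t) 1) (\<lambda>g. mdist \<rho> g \<one> powr p))"
  define b where "b = (\<lambda>t. measure_pmf.expectation (walk_pmf G (\<mu> t) t) (\<lambda>g. mdist \<rho> g \<one>))"
  have sym: "symmetric_pmf_on G (\<mu> t)" and int: "integrable (\<mu> t) (\<lambda>g. mdist \<rho> g \<one> powr p)" if "1 \<le> t" for t
    using adm that unfolding admissible_seq_def by auto
  have s_eq: "s t = real t * measure_pmf.expectation (\<mu> t) (\<lambda>g. mdist \<rho> g \<one> powr p)" if "1 \<le> t" for t
    using walk_pmf_1[OF grp, of "\<mu> t"] sym[OF that] unfolding s_def symmetric_pmf_on_def by simp
  have "\<delta> powr p * (real t * measure_pmf.prob (\<mu> t) (carrier G - {\<one>})) \<le> s t" if t: "1 \<le> t" for t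
  proof -
    have "\<delta> powr p * measure_pmf.prob (\<mu> t) (carrier G - {\<one>})
        = measure_pmf.expectation (\<mu> t) (\<lambda>g. \<delta> powr p * indicator (carrier G - {\<one>}) g)"
      by simp
    also have "\<dots> \<le> measure_pmf.expectation (\<mu> t) (\<lambda>g. mdist \<rho> g \<one> powr p)"
    proof (rule integral_mono)
      show "integrable (\<mu> t) (\<lambda>g. \<delta> powr p * indicator (carrier G - {\<one>}) g)"
        by (intro integrable_mult_right measure_pmf.integrable_const_bound[of _ 1]) (auto simp: indicator_def)
      show "\<delta> powr p * indicator (carrier G - {\<one>}) g \<le> mdist \<rho> g \<one> powr p" for g
        using \<delta> p by (auto simp: indicator_def intro!: powr_mono2)
    qed (rule int[OF t])
    finally show ?thesis
      using t unfolding s_eq[OF t] by (simp add: mult_left_mono algebra_simps)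
  qed
  moreover have "filterlim (\<lambda>t. \<delta> powr p * (real t * measure_pmf.prob (\<mu> t) (carrier G - {\<one>}))) at_top sequentially"
    using adm \<delta> unfolding admissible_seq_def
    by (intro filterlim_tendsto_pos_mult_at_top[OF tendsto_const]) auto
  ultimately have s_top: "filterlim s at_top sequentially"
    by (elim filterlim_at_top_mono) (auto simp: eventually_sequentially)
  obtain C where C: "0 < C" and bC: "\<And>t. 1 \<le> t \<Longrightarrow> 0 < s t \<Longrightarrow> b t \<le> C * s t powr \<gamma>"
  proof -
    obtain C where C: "0 < C" and "\<And>\<nu> t. symmetric_pmf_on G \<nu> \<Longrightarrow> integrable \<nu> (\<lambda>g. mdist \<rho> g \<one> powr p) \<Longrightarrow>
        0 < real t * measure_pmf.expectation \<nu> (\<lambda>g. mdist \<rho> g \<one> powr p) \<Longrightarrow>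
        measure_pmf.expectation (walk_pmf G \<nu> t) (\<lambda>w. mdist \<rho> w \<one>)
          \<le> C * (real t * measure_pmf.expectation \<nu> (\<lambda>g. mdist \<rho> g \<one> powr p)) powr \<gamma>"
      using gr unfolding walk_mean_growth_def by blast
    from this(2)[OF sym int] have "b t \<le> C * s t powr \<gamma>" if "1 \<le> t" "0 < s t" for t
      using that unfolding b_def by (simp add: s_eq)
    with C show thesis by (rule that)
  qed
  have ev: "\<forall>\<^sub>F t in sequentially. log_ereal (b t) / log_ereal (s t) \<le> ereal (ln C / ln (s t) + \<gamma>)"
    using filterlim_at_top_dense[THEN iffD1, OF s_top, rule_format, of 1] eventually_ge_at_top[of 1]
  proof eventually_elim
    fix t assume t: "1 < s t" "1 \<le> t"
    have l: "log_ereal (s t) = ereal (ln (s t))" "0 < ln (s t)"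
      using t by (auto simp: log_ereal_def)
    \<comment> \<open>If the walk is almost surely at the identity at time \<open>t\<close>, the quotient is \<open>-\<infinity>\<close>.\<close>
    show "log_ereal (b t) / log_ereal (s t) \<le> ereal (ln C / ln (s t) + \<gamma>)"
    proof (cases "b t \<le> 0")
      case True
      then show ?thesis using l by (simp add: log_ereal_def)
    next
      case False
      have "ln (b t) \<le> ln (C * s t powr \<gamma>)"
        using False bC[of t] t by (subst ln_le_cancel_iff) (use C in auto)
      also have "\<dots> = ln C + \<gamma> * ln (s t)" using C t by (simp add: ln_mult ln_powr)
      finally have "ln (b t) / ln (s t) \<le> ln C / ln (s t) + \<gamma>"
        using l by (simp add: field_simps)
      then show ?thesis using False l by (simp add: log_ereal_def)
    qed
  qed
  have "(\<lambda>t. ln C / ln (s t) + \<gamma>) \<longlonglongrightarrow> 0 + \<gamma>"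
    by (intro tendsto_add tendsto_const tendsto_divide_0[OF tendsto_const]
        filterlim_at_top_imp_at_infinity filterlim_compose[OF ln_at_top s_top])
  then have "limsup (\<lambda>t. ereal (ln C / ln (s t) + \<gamma>)) = ereal \<gamma>"
    by (intro lim_imp_Limsup) auto
  then show ?thesis
    using Limsup_mono[OF ev] unfolding beta_star_seq_def s_def b_def by simp
qed

lemma beta_star_le:
  fixes G (structure)
  assumes grp: "group G" and inv: "left_invariant_metric G \<rho>"
    and ball: "\<And>r. 0 \<le> r \<Longrightarrow> finite {x \<in> carrier G. mdist \<rho> x \<one> \<le> r}" and p: "0 \<le> p"
    and gr: "walk_mean_growth G \<rho> p \<gamma>" and \<gamma>: "0 \<le> \<gamma>"
  shows "beta_star G \<rho> p \<le> ereal \<gamma>"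
  unfolding beta_star_def Sup0_def
  using beta_star_seq_le[OF grp inv ball p gr] \<gamma> by (auto intro!: Sup_least)

text \<open>Whatever the earlier position \<open>w\<close> is, the last step must be exactly \<open>w\<^bsup>-1\<^esup>\<close> to return.\<close>
lemma walk_pmf_identity_atom:
  fixes G (structure)
  assumes grp: "group G" and sub: "set_pmf \<mu> \<subseteq> carrier G"
    and a: "\<And>g. g \<in> carrier G \<Longrightarrow> pmf \<mu> g \<le> a"
  shows "pmf (walk_pmf G \<mu> (Suc t)) \<one> \<le> a"
proof -
  interpret group G by fact
  have "pmf (walk_pmf G \<mu> (Suc t)) \<one> = (\<integral>w. pmf (map_pmf ((\<otimes>) w) \<mu>) \<one> \<partial>walk_pmf G \<mu> t)"
    by (simp add: walk_pmf_Suc_right[OF grp sub] pmf_bind)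
  also have "\<dots> \<le> a"
  proof (intro measure_pmf.integral_le_const)
    show "integrable (walk_pmf G \<mu> t) (\<lambda>w. pmf (map_pmf ((\<otimes>) w) \<mu>) \<one>)"
      by (intro measure_pmf.integrable_const_bound[of _ 1]) (auto simp: pmf_le_1)
    have "pmf (map_pmf ((\<otimes>) w) \<mu>) \<one> \<le> a" if "w \<in> carrier G" for w
      using pmf_map_inj_on[of "(\<otimes>) w" "carrier G" \<mu> "inv w"] a[of "inv w"] that sub
      by (simp add: inj_on_def)
    then show "AE w in walk_pmf G \<mu> t. pmf (map_pmf ((\<otimes>) w) \<mu>) \<one> \<le> a"
      using set_walk_pmf[OF grp sub, of t] by (auto simp: AE_measure_pmf_iff)
  qed
  finally show ?thesis .
qed

text \<open>On a nontrivial group, take a fixed step law \<open>\<mu>\<close>, uniform on \<open>{e, g, g\<^bsup>-1\<^esup>}\<close>. Its atoms have mass at most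
  \<open>1/2\<close>, also when \<open>g\<close> is an involution, so the walk is away from the identity with probability at least \<open>1/2\<close> at every
  positive time. The expected displacement is bounded below while the denominator grows like \<open>log t\<close>.
  Dropping \<open>e\<close> would make the walk on the group of order two return at all even times.\<close>
lemma beta_star_nonneg:
  fixes G (structure)
  assumes grp: "group G" and inv: "left_invariant_metric G \<rho>"
    and ball: "\<And>r. 0 \<le> r \<Longrightarrow> finite {x \<in> carrier G. mdist \<rho> x \<one> \<le> r}"
  shows "0 \<le> beta_star G \<rho> p"
proof (cases "carrier G = {\<one>}")
  case True
  have "\<not> filterlim (\<lambda>t::nat. 0::real) at_top sequentially"
    using filterlim_at_top_dense[of "\<lambda>t::nat. 0::real" sequentially] by (auto intro!: exI[of _ 0])
  then have "\<not> admissible_seq G \<rho> p \<mu>" for \<mu>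
    using True unfolding admissible_seq_def by simp
  then show ?thesis by (simp add: beta_star_def Sup0_def)
next
  case False
  interpret group G by fact
  obtain g where g: "g \<in> carrier G" "g \<noteq> \<one>" using False one_closed by blast
  obtain \<delta> where \<delta>: "0 < \<delta>" "\<And>g. g \<in> carrier G \<Longrightarrow> g \<noteq> \<one> \<Longrightarrow> \<delta> \<le> mdist \<rho> g \<one>"
    using identity_isolated[OF grp inv ball] by metis
  define A where "A = {\<one>, g, inv g}"
  define \<mu> where "\<mu> = pmf_of_set A"
  have A: "finite A" "A \<noteq> {}" "A \<subseteq> carrier G" using g unfolding A_def by auto
  have set: "set_pmf \<mu> = A" using A unfolding \<mu>_def by simp
  have sub: "set_pmf \<mu> \<subseteq> carrier G" using A set by simp
  have Ainv: "inv x \<in> A" if "x \<in> A" for x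
    using that g unfolding A_def by auto
  have Aiff: "x \<in> A \<longleftrightarrow> inv x \<in> A" if "x \<in> carrier G" for x
    using Ainv[of x] Ainv[of "inv x"] that by auto
  have "pmf \<mu> x = pmf \<mu> (inv x)" if "x \<in> carrier G" for x
    unfolding \<mu>_def pmf_of_set[OF A(2,1)] indicator_def using Aiff[OF that] by simp
  then have sym: "symmetric_pmf_on G \<mu>"
    using sub unfolding symmetric_pmf_on_def by blast
  have pp: "0 < measure_pmf.prob \<mu> (carrier G - {\<one>})"
    using g set by (intro measure_pmf_posI[of g]) (auto simp: A_def)
  have adm: "admissible_seq G \<rho> p (\<lambda>_. \<mu>)"
    unfolding admissible_seq_def
  proof (intro conjI allI impI sym)
    show "integrable \<mu> (\<lambda>x. mdist \<rho> x \<one> powr p)"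
      using A set by (intro integrable_measure_pmf_finite) simp
    show "filterlim (\<lambda>t. real t * measure_pmf.prob \<mu> (carrier G - {\<one>})) at_top sequentially"
      using filterlim_tendsto_pos_mult_at_top[OF tendsto_const pp filterlim_real_sequentially]
      by (simp add: mult.commute)
  qed
  have "card {\<one>, g} \<le> card A" using A by (intro card_mono) (auto simp: A_def)
  then have "2 \<le> real (card A)" using g by simp
  then have half: "pmf \<mu> x \<le> 1/2" for x
    unfolding \<mu>_def pmf_of_set[OF A(2,1)] indicator_def by (simp add: field_simps)
  define E where "E = measure_pmf.expectation (walk_pmf G \<mu> 1) (\<lambda>g. mdist \<rho> g \<one> powr p)"
  define b where "b = (\<lambda>t. measure_pmf.expectation (walk_pmf G \<mu> t) (\<lambda>g. mdist \<rho> g \<one>))"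
  have E: "0 < E"
  proof -
    have "mdist \<rho> g \<one> powr p * pmf \<mu> g \<le> (\<Sum>x\<in>A. mdist \<rho> x \<one> powr p * pmf \<mu> x)"
      using A by (intro member_le_sum[of g A "\<lambda>x. mdist \<rho> x \<one> powr p * pmf \<mu> x"]) (auto simp: A_def)
    also have "\<dots> = E"
      unfolding E_def walk_pmf_1[OF grp sub] using A set by (subst integral_measure_pmf_real[of A]) auto
    finally have "mdist \<rho> g \<one> powr p * pmf \<mu> g \<le> E" .
    moreover have "0 < mdist \<rho> g \<one>" using \<delta> g by force
    moreover have "0 < pmf \<mu> g" using set by (intro pmf_positive) (auto simp: A_def)
    ultimately show ?thesis by (smt (verit) mult_pos_pos powr_gt_zero)
  qed
  have b: "\<delta> / 2 \<le> b t" if "1 \<le> t" for t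
  proof -
    obtain u where u: "t = Suc u" using \<open>1 \<le> t\<close> by (cases t) auto
    have "\<delta> / 2 \<le> \<delta> * (1 - pmf (walk_pmf G \<mu> t) \<one>)"
      using walk_pmf_identity_atom[OF grp sub half, of u] \<delta> unfolding u by simp
    also have "\<dots> = \<delta> * measure_pmf.prob (walk_pmf G \<mu> t) (- {\<one>})"
      using measure_pmf.prob_compl[of "{\<one>}" "walk_pmf G \<mu> t"]
      by (simp add: measure_pmf_single Compl_eq_Diff_UNIV)
    also have "\<dots> = measure_pmf.expectation (walk_pmf G \<mu> t) (\<lambda>w. \<delta> * indicator (- {\<one>}) w)" by simp
    also have "\<dots> \<le> b t"
      unfolding b_def
    proof (intro integral_mono_AE integrable_measure_pmf_finite)
      show "finite (set_pmf (walk_pmf G \<mu> t))" using A set by (intro finite_set_walk_pmf) simp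
      then show "finite (set_pmf (walk_pmf G \<mu> t))" .
      show "AE w in walk_pmf G \<mu> t. \<delta> * indicator (- {\<one>}) w \<le> mdist \<rho> w \<one>"
        using set_walk_pmf[OF grp sub, of t] \<delta> by (auto simp: AE_measure_pmf_iff indicator_def)
    qed
    finally show ?thesis .
  qed
  have s_top: "filterlim (\<lambda>t. real t * E) at_top sequentially"
    using filterlim_tendsto_pos_mult_at_top[OF tendsto_const E filterlim_real_sequentially]
    by (simp add: mult.commute)
  have ev: "\<forall>\<^sub>F t in sequentially. ereal (ln (\<delta> / 2) / ln (real t * E))
      \<le> log_ereal (b t) / log_ereal (real t * E)"
    using filterlim_at_top_dense[THEN iffD1, OF s_top, rule_format, of 1] eventually_ge_at_top[of 1]
  proof eventually_elim
    fix t :: nat assume t: "1 < real t * E" "1 \<le> t"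
    have l: "0 < ln (real t * E)" using t by simp
    have "0 < b t" "ln (\<delta> / 2) \<le> ln (b t)" using b[OF t(2)] \<delta> by auto
    then show "ereal (ln (\<delta> / 2) / ln (real t * E)) \<le> log_ereal (b t) / log_ereal (real t * E)"
      using t l by (simp add: log_ereal_def divide_right_mono)
  qed
  have "(\<lambda>t. ln (\<delta> / 2) / ln (real t * E)) \<longlonglongrightarrow> 0"
    by (intro tendsto_divide_0[OF tendsto_const]
        filterlim_at_top_imp_at_infinity filterlim_compose[OF ln_at_top s_top])
  then have "limsup (\<lambda>t. ereal (ln (\<delta> / 2) / ln (real t * E))) = ereal 0"
    by (intro lim_imp_Limsup) auto
  then have "0 \<le> beta_star_seq G \<rho> p (\<lambda>_. \<mu>)"
    using Limsup_mono[OF ev] unfolding beta_star_seq_def b_def E_def by (simp add: zero_ereal_def)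
  also have "\<dots> \<le> beta_star G \<rho> p"
    unfolding beta_star_def Sup0_def using adm by (auto intro!: Sup_upper)
  finally show ?thesis .
qed

section \<open>Compression and beta\<close>

theorem theorem5p1:
  fixes G :: "('a, 'm) monoid_scheme" (structure)
    and X :: "'b metric" and \<rho> :: "'a metric" and p :: real
  assumes "group G" and "finitely_generated_group G"
    and "1 \<le> p"
    and "amenable_group G"
    and "has_markov_type X p"
    and "left_invariant_metric G \<rho>"
    and "\<And>r. 0 \<le> r \<Longrightarrow> finite {x \<in> carrier G. mdist \<rho> x \<one> \<le> r}"
  shows "compression_exponent X \<rho> \<le> 1 / (ereal p * beta_star G \<rho> p)"
proof -
  note grp = assms(1) and p = assms(3) and am = assms(4) and inv = assms(6) and ball = assms(7)
  have p0: "0 \<le> p" using p by simp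
  have mG: "mspace \<rho> = carrier G" using inv by (simp add: left_invariant_metric_def)
  have beta1: "beta_star G \<rho> p \<le> ereal 1"
    by (rule beta_star_le[OF grp inv ball p0 walk_mean_growth_linear[OF grp inv ball p]]) simp_all
  then obtain b where b: "beta_star G \<rho> p = ereal b" "0 \<le> b" "b \<le> 1"
    using beta_star_nonneg[OF grp inv ball, of p] by (cases "beta_star G \<rho> p") auto
  obtain K where K: "\<And>n. markov_type_bound X p K {1..n::nat}"
    using assms(5) unfolding has_markov_type_def markov_type_bound_def by blast
  have *: "ereal \<alpha> \<le> 1 / (ereal p * beta_star G \<rho> p)"
    if \<alpha>: "0 \<le> \<alpha>" and lip: "Lipschitz_continuous_map \<rho> X f" and c: "0 < c"
      "\<And>x y. x \<in> mspace \<rho> \<Longrightarrow> y \<in> mspace \<rho> \<Longrightarrow> c * mdist \<rho> x y powr \<alpha> \<le> mdist X (f x) (f y)" for \<alpha> f c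
  proof (cases "b = 0")
    case True
    then show ?thesis using b by (simp add: divide_ereal_def)
  next
    case False
    then have b0: "0 < b" using b by simp
    have "b * (\<alpha> * p) \<le> 1"
    proof (cases "1 \<le> \<alpha> * p")
      case True
      obtain L where L: "L > 0" "\<And>x y. x \<in> mspace \<rho> \<Longrightarrow> y \<in> mspace \<rho> \<Longrightarrow> mdist X (f x) (f y) \<le> L * mdist \<rho> x y"
        and f: "f \<in> mspace \<rho> \<rightarrow> mspace X"
        using lip unfolding Lipschitz_continuous_map_pos by blast
      have "walk_mean_growth G \<rho> p (1 / (\<alpha> * p))"
        using walk_mean_growth_from_compression[OF am inv ball p0 K, of f L c \<alpha>] f L c True
        unfolding mG by simp
      then have "beta_star G \<rho> p \<le> ereal (1 / (\<alpha> * p))"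
        using True by (intro beta_star_le[OF grp inv ball p0]) auto
      then show ?thesis using b True by (simp add: field_simps)
    next
      case False
      then show ?thesis using mult_le_one[of b "\<alpha> * p"] b \<alpha> p0 by simp
    qed
    then have "\<alpha> * (p * b) \<le> 1" by (simp add: mult.commute mult.left_commute)
    then have "\<alpha> \<le> 1 / (p * b)" using b0 p by (subst pos_le_divide_eq) auto
    moreover have "1 / (ereal p * beta_star G \<rho> p) = ereal (1 / (p * b))"
      using b b0 p by (simp add: divide_ereal_def divide_inverse)
    ultimately show ?thesis by simp
  qed
  have "0 \<le> 1 / (ereal p * beta_star G \<rho> p)"
    using b p by (cases "b = 0") (simp_all add: divide_ereal_def)
  then show ?thesis
    unfolding compression_exponent_def Sup0_def
    by (auto intro!: Sup_least) (metis *)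
qed

end
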